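(* Let $n,m\in\mathbb{N}^*$, $A\in\mathbb{R}^{n\times n}$, $B\in\mathbb{R}^{n\times m}$, let $Q\in\mathbb{R}^{n\times n}$ and $R\in\mathbb{R}^{m\times m}$ be symmetric positive definite matrices, and assume that for every $x_0\in\mathbb{R}^n$ there exists a pair $(x,u)\in\mathrm{AC}([0,+\infty),\mathbb{R}^n)\times\mathrm{L}^2([0,+\infty),\mathbb{R}^m)$ such that $\dot x(t)=Ax(t)+Bu(t)$ for almost every $t\ge0$, $x(0)=x_0$, and $$\int_0^{+\infty}\Big(\langle Qx(\tau),x(\tau)\rangle_{\mathbb{R}^n}+\langle Ru(\tau),u(\tau)\rangle_{\mathbb{R}^m}\Big)\,d\tau<+\infty.$$ Then there exist $\overline h>0$ and $\overline c\ge0$ such that, for all $h$ with $0<h\le\overline h$, denoting by $\Delta=\{ih\}_{i\in\mathbb{N}}$ the $h$-uniform time partition of $[0,+\infty)$, and for every $x_0\in\mathbb{R}^n$, there exists a pair $(x,u)\in\mathrm{AC}([0,+\infty),\mathbb{R}^n)\times\mathrm{PC}^\Delta([0,+\infty),\mathbb{R}^m)$ such that $\dot x(t)=Ax(t)+Bu(t)$ for almost every $t\ge0$ and $x(0)=x_0$, satisfying $$\int_0^{+\infty}\Big(\langle Qx(\tau),x(\tau)\rangle_{\mathbb{R}^n}+\langle Ru(\tau),u(\tau)\rangle_{\mathbb{R}^m}\Big)\,d\tau\le\overline c\,\langle E^\infty x_0,x_0\rangle_{\mathbb{R}^n}<+\infty.$$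
   Context: $\mathbb{N}=\{0,1,2,\dots\}$, $\mathbb{N}^*=\mathbb{N}\setminus\{0\}$. $\mathrm{AC}([0,+\infty),\mathbb{R}^n)$ is the set of functions $[0,+\infty)\to\mathbb{R}^n$ that are absolutely continuous on $[0,T]$ for every $T>0$. For $\Delta=\{t_i\}_{i\in\mathbb{N}}$ with $t_i=ih$, $\mathrm{PC}^\Delta([0,+\infty),\mathbb{R}^m)$ is the set of functions $u:[0,+\infty)\to\mathbb{R}^m$ such that, for each $i\in\mathbb{N}$, $u(t)=u_i$ for all $t\in[t_i,t_{i+1})$, for some $u_i\in\mathbb{R}^m$. $E^\infty$ denotes the unique symmetric positive semi-definite matrix $E\in\mathbb{R}^{n\times n}$ solving the algebraic Riccati equation $$EBR^{-1}B^\top E-Q-A^\top E-EA=0_{\mathbb{R}^{n\times n}}.$$ Under the hypotheses of the claim, it is well known that this solution exists, is unique and is positive definite, and that $\langle E^\infty x_0,x_0\rangle_{\mathbb{R}^n}$ is the minimal value of $\int_0^{+\infty}(\langle Qx,x\rangle_{\mathbb{R}^n}+\langle Ru,u\rangle_{\mathbb{R}^m})\,d\tau$ over all $(x,u)\in\mathrm{AC}([0,+\infty),\mathbb{R}^n)\times\mathrm{L}^2([0,+\infty),\mathbb{R}^m)$ with $\dot x=Ax+Bu$ a.e. and $x(0)=x_0$. *)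

theory Defs
  imports "HOL-Analysis.Analysis"
begin

definition sym_pos_semidef :: "real^'n^'n \<Rightarrow> bool" where
  "sym_pos_semidef M \<longleftrightarrow> transpose M = M \<and> (\<forall>x. 0 \<le> (M *v x) \<bullet> x)"

definition sym_pos_def :: "real^'n^'n \<Rightarrow> bool" where
  "sym_pos_def M \<longleftrightarrow> transpose M = M \<and> (\<forall>x. x \<noteq> 0 \<longrightarrow> 0 < (M *v x) \<bullet> x)"

text \<open>
  The usual epsilon-delta definition. A division of a subset of \<open>{a..b}\<close> is a finite set of
  nonempty compact intervals \<open>k = {Inf k..Sup k}\<close> with pairwise disjoint interiors.
\<close>
definition abs_continuous_on_interval :: "real \<Rightarrow> real \<Rightarrow> (real \<Rightarrow> 'a::real_normed_vector) \<Rightarrow> bool" where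
  "abs_continuous_on_interval a b f \<longleftrightarrow>
    (\<forall>\<epsilon>>0. \<exists>\<delta>>0. \<forall>d S. d division_of S \<and> S \<subseteq> {a..b} \<and> (\<Sum>k\<in>d. Sup k - Inf k) < \<delta>
       \<longrightarrow> (\<Sum>k\<in>d. norm (f (Sup k) - f (Inf k))) < \<epsilon>)"

text \<open>
  Functions on the half-line \<open>[0,+\<infinity>)\<close> are total functions on \<open>real\<close> whose values at
  negative arguments are irrelevant: every notion below only inspects the values on \<open>{0..}\<close>.
\<close>

definition AC_halfline :: "(real \<Rightarrow> 'a::real_normed_vector) set" where
  "AC_halfline = {x. \<forall>T>0. abs_continuous_on_interval 0 T x}"

definition L2_halfline :: "(real \<Rightarrow> 'a::euclidean_space) set" where
  "L2_halfline = {u. u \<in> borel_measurable (lebesgue_on {0..}) \<and>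
                     integrable (lebesgue_on {0..}) (\<lambda>t. (norm (u t))\<^sup>2)}"

definition PC_halfline :: "(nat \<Rightarrow> real) \<Rightarrow> (real \<Rightarrow> 'a) set" where
  "PC_halfline t = {u. \<forall>i. \<exists>c. \<forall>s\<in>{t i..<t (Suc i)}. u s = c}"

definition uniform_partition :: "real \<Rightarrow> nat \<Rightarrow> real" where
  "uniform_partition h i = real i * h"

definition solves_linear_control ::
  "real^'n^'n \<Rightarrow> real^'m^'n \<Rightarrow> real^'n \<Rightarrow> (real \<Rightarrow> real^'n) \<Rightarrow> (real \<Rightarrow> real^'m) \<Rightarrow> bool" where
  "solves_linear_control A B x0 x u \<longleftrightarrow>
     (AE t in lebesgue_on {0..}.
        (x has_vector_derivative (A *v x t + B *v u t)) (at t within {0..})) \<and> x 0 = x0"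

text \<open>
  The cost is an extended nonnegative number. It is used only for positive definite \<open>Q\<close>
  and \<open>R\<close>, so that the coercion \<open>ennreal\<close> does not truncate the integrand.
\<close>
definition quadratic_cost ::
  "real^'n^'n \<Rightarrow> real^'m^'m \<Rightarrow> (real \<Rightarrow> real^'n) \<Rightarrow> (real \<Rightarrow> real^'m) \<Rightarrow> ennreal" where
  "quadratic_cost Q R x u =
     (\<integral>\<^sup>+ t. ennreal ((Q *v x t) \<bullet> x t + (R *v u t) \<bullet> u t) \<partial>lebesgue_on {0..})"

definition riccati_solution ::
  "real^'n^'n \<Rightarrow> real^'m^'n \<Rightarrow> real^'n^'n \<Rightarrow> real^'m^'m \<Rightarrow> real^'n^'n \<Rightarrow> bool" where
  "riccati_solution A B Q R E \<longleftrightarrow>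
     E ** B ** matrix_inv R ** transpose B ** E - Q - transpose A ** E - E ** A = 0"

text \<open>
  The definite description is meaningful only where a unique solution exists, e.g. for
  positive definite \<open>Q\<close> and \<open>R\<close> when every initial state admits a control of finite cost.
\<close>
definition E_inf ::
  "real^'n^'n \<Rightarrow> real^'m^'n \<Rightarrow> real^'n^'n \<Rightarrow> real^'m^'m \<Rightarrow> real^'n^'n" where
  "E_inf A B Q R = (THE E. sym_pos_semidef E \<and> riccati_solution A B Q R E)"

end

theory Submission
  imports Defs
begin

text \<open>
  The value function of the problem, an infimum over admissible pairs, satisfies the parallelogram
  law because the cost does, so it is \<open>\<langle>E x, x\<rangle>\<close> for a symmetric \<open>E\<close>. Along any trajectory,
  completing the square turns the derivative of \<open>\<langle>E x, x\<rangle>\<close> plus the running cost into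
  \<open>\<langle>D x, x\<rangle> + \<langle>R (u + K x), u + K x\<rangle>\<close>, where \<open>D\<close> is the defect of \<open>E\<close> in the Riccati equation
  and \<open>K\<close> is the optimal gain. Constant controls on short intervals give \<open>D \<ge> 0\<close>, almost optimal
  controls give \<open>D \<le> 0\<close>, so \<open>E\<close> solves the equation. The same identity, applied to the closed loop and
  to arbitrary admissible pairs, shows that every positive semidefinite solution represents the
  value function, whence uniqueness.

  For the feedback held constant on sampling intervals, \<open>u = - K z\<close> with \<open>z\<close> the last sample, the identity
  reads: running cost plus derivative of \<open>\<langle>E x, x\<rangle>\<close> equals \<open>\<langle>R K (x - z), K (x - z)\<rangle>\<close>. As
  \<open>|x - z| = O(h |x|)\<close>, for small \<open>h\<close> the right-hand side is at most half the running cost, and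
  integration bounds the total cost by \<open>2 \<langle>E x0, x0\<rangle>\<close>.
\<close>

section \<open>Absolutely continuous functions and linear differential equations\<close>

text \<open>Only almost optimal controls are available, because the argument works with an infimum
  and two dynamic programming inequalities: cutting off an initial segment and prepending one. Costs
  are truncated at finite horizons and trajectories are kept in integral form, so that shifting,
  gluing and superposing them creates no null sets; the almost-everywhere formulation of the
  hypothesis is converted at one point only. At infinity, finite cost yields just that the state is
  small at some time, and one such time suffices to remove the terminal term from the energy
  identity. The sampling error is measured against the current state instead of the last sample,
  hence against the running cost at the same instant; it is absorbed pointwise, before anything is
  known about the long-time behaviour of the sampled loop. The factor 2 is what remains after half
  of the cost has been absorbed.\<close>

text \<open>Henstock's proof of the fundamental theorem with an exceptional null set. The gauge
  confines intervals tagged in \<open>N\<close> to an open set of measure below \<delta>, where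
  absolute continuity controls the increments of \<open>f\<close>; at all other tags
  differentiability gives the usual straddle estimate.\<close>

lemma abs_continuous_on_interval_has_integral:
  fixes f :: "real \<Rightarrow> 'a::banach"
  assumes "a \<le> b" and ac: "abs_continuous_on_interval a b f" and N: "negligible N"
    and deriv: "\<And>t. t \<in> {a..b} - N \<Longrightarrow> (f has_vector_derivative g t) (at t within {a..b})"
  shows "(g has_integral f b - f a) {a..b}"
proof (cases "a = b")
  case True
  then show ?thesis using has_integral_refl(2)[of g b] by simp
next
  case False
  with \<open>a \<le> b\<close> have "a < b" by simp
  \<comment> \<open>Nothing is known about \<open>g\<close> on \<open>N\<close>. With the value 0
    there, intervals tagged in \<open>N\<close> contribute only increments of \<open>f\<close>; the
    change is undone at the end because \<open>N\<close> is negligible.\<close>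
  define g' where "g' t = (if t \<in> N then 0 else g t)" for t
  have "(g' has_integral f b - f a) {a..b}"
    unfolding has_integral_factor_content_real
  proof (intro allI impI)
    fix e :: real
    assume "e > 0"
    have "e / 2 * (b - a) > 0" using \<open>e > 0\<close> \<open>a < b\<close> by simp
    then obtain \<delta> where "\<delta> > 0" and \<delta>: "\<And>d S. d division_of S \<Longrightarrow> S \<subseteq> {a..b} \<Longrightarrow>
        (\<Sum>k\<in>d. Sup k - Inf k) < \<delta> \<Longrightarrow> (\<Sum>k\<in>d. norm (f (Sup k) - f (Inf k))) < e / 2 * (b - a)"
      using ac[unfolded abs_continuous_on_interval_def, THEN spec, THEN mp] by meson
    have N0: "N \<in> null_sets lebesgue" using N by (simp add: negligible_iff_null_sets)
    obtain U where U: "open U" "N \<subseteq> U" "U - N \<in> lmeasurable" "emeasure lebesgue (U - N) < ennreal \<delta>"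
      using sets_lebesgue_outer_open[of N \<delta>] N0 \<open>\<delta> > 0\<close> by blast
    have UN: "U = (U - N) \<union> N" using U by auto
    have Um: "U \<in> lmeasurable"
      using fmeasurable.Un[OF U(3) fmeasurableI_null_sets[OF N0]] UN by simp
    have "measure lebesgue U = measure lebesgue (U - N)"
      using N0 Um by (simp add: measure_Diff_null_set fmeasurableD)
    also have "\<dots> < \<delta>"
      using U(3,4) \<open>\<delta> > 0\<close> by (simp add: emeasure_eq_measure2 ennreal_less_iff)
    finally have mU: "measure lebesgue U < \<delta>" .
    have "\<exists>d>0. (x \<in> {a..b} - N \<longrightarrow>
         (\<forall>y\<in>{a..b}. norm (y-x) < d \<longrightarrow> norm (f y - f x - (y-x) *\<^sub>R g x) \<le> e / 2 * norm (y-x)))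
        \<and> (x \<in> N \<longrightarrow> ball x d \<subseteq> U)" for x
    proof (cases "x \<in> N")
      case True
      then show ?thesis using U open_contains_ball by auto
    next
      case False
      show ?thesis
      proof (cases "x \<in> {a..b}")
        case True
        with False have "(f has_vector_derivative g x) (at x within {a..b})" using deriv by simp
        then have "\<exists>d>0. \<forall>y\<in>{a..b}. norm (y-x) < d \<longrightarrow> norm (f y - f x - (y-x) *\<^sub>R g x) \<le> e / 2 * norm (y-x)"
          unfolding has_vector_derivative_def has_derivative_within_alt using \<open>e > 0\<close>
          by (metis half_gt_zero)
        then show ?thesis using False by blast
      qed (use False in \<open>auto intro: exI[of _ 1]\<close>)
    qed
    then obtain d where d: "\<And>x. 0 < d x"
        "\<And>x y. \<lbrakk>x \<in> {a..b} - N; y \<in> {a..b}; norm (y-x) < d x\<rbrakk>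
                        \<Longrightarrow> norm (f y - f x - (y-x) *\<^sub>R g x) \<le> e / 2 * norm (y-x)"
        "\<And>x. x \<in> N \<Longrightarrow> ball x (d x) \<subseteq> U"
      by metis
    show "\<exists>d. gauge d \<and> (\<forall>p. p tagged_division_of {a..b} \<and> d fine p \<longrightarrow>
      norm ((\<Sum>(x, k)\<in>p. measure lborel k *\<^sub>R g' x) - (f b - f a)) \<le> e * measure lborel {a..b})"
    proof (rule exI, safe)
      show "gauge (\<lambda>x. ball x (d x))"
        using d(1) gauge_ball_dependent by blast
    next
      fix p
      assume ptag: "p tagged_division_of {a..b}" and finep: "(\<lambda>x. ball x (d x)) fine p"
      have "finite p" using ptag by (rule tagged_division_ofD)
      have ba: "b - a = (\<Sum>(x,K)\<in>p. Sup K - Inf K)" "f b - f a = (\<Sum>(x,K)\<in>p. f(Sup K) - f(Inf K))"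
        using additive_tagged_division_1[where f= "\<lambda>x. x"] additive_tagged_division_1[where f= f]
              \<open>a \<le> b\<close> ptag by auto
      have pK: "\<exists>u v. K = {u..v} \<and> u \<le> v \<and> x \<in> K \<and> K \<subseteq> {a..b} \<and> K \<subseteq> ball x (d x)" if xK: "(x,K) \<in> p" for x K
      proof -
        obtain u v where "K = cbox u v" using tagged_division_ofD(4)[OF ptag xK] by blast
        moreover have "x \<in> K" "K \<subseteq> {a..b}" using tagged_division_ofD(2,3)[OF ptag xK] by auto
        moreover have "K \<subseteq> ball x (d x)" using fineD[OF finep xK] by simp
        ultimately show ?thesis by auto
      qed
      define p' where "p' = {(x,K). (x,K) \<in> p \<and> x \<in> N}"
      have "p' \<subseteq> p" by (auto simp: p'_def)
      have p'tag: "p' tagged_partial_division_of {a..b}"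
        using tagged_partial_division_subset[OF conjunct1[OF ptag[unfolded tagged_division_of_def]] \<open>p' \<subseteq> p\<close>] .
      then have "finite p'" by (rule tagged_partial_division_ofD)
      note div = partial_division_of_tagged_division[OF p'tag]
      have sum': "(\<Sum>(x,K)\<in>p'. norm (f(Sup K) - f(Inf K))) < e / 2 * (b - a)"
      proof -
        have "(\<Sum>(x,K)\<in>p'. norm (f(Sup K) - f(Inf K))) = (\<Sum>K\<in>snd ` p'. norm (f (Sup K) - f (Inf K)))"
        \<comment> \<open>Passing from tagged intervals to intervals loses nothing: an interval
          carrying two tags has empty interior, so it is a point and its increment vanishes.\<close>
        proof (subst sum.reindex_nontrivial)
          fix y z assume yz: "y \<in> p'" "z \<in> p'" "y \<noteq> z" "snd y = snd z"
          obtain u v where K: "snd y = {u..v}" "u \<le> v"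
            using pK[of "fst y" "snd y"] yz(1) by (auto simp: p'_def)
          have "interior (snd y) \<inter> interior (snd z) = {}"
            using tagged_partial_division_ofD(5)[OF p'tag, of "fst y" "snd y" "fst z" "snd z"] yz
            by (metis prod.collapse)
          then have "u = v" using K yz(4) by (simp add: interior_atLeastAtMost_real)
          then show "norm (f (Sup (snd y)) - f (Inf (snd y))) = 0" using K by simp
        qed (use \<open>finite p'\<close> in \<open>auto simp: split_def\<close>)
        also have "\<dots> < e / 2 * (b - a)"
        proof (rule \<delta>[OF div])
          show "\<Union> (snd ` p') \<subseteq> {a..b}" using tagged_partial_division_ofD(3)[OF p'tag]
            by (intro Union_least) force
          have "(\<Sum>k\<in>snd ` p'. Sup k - Inf k) = (\<Sum>k\<in>snd ` p'. measure lebesgue k)"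
          proof (rule sum.cong[OF refl])
            fix K assume "K \<in> snd ` p'"
            then obtain x where "(x,K) \<in> p" by (auto simp: p'_def)
            from pK[OF this] show "Sup K - Inf K = measure lebesgue K" by auto
          qed
          also have "\<dots> = measure lebesgue (\<Union> (snd ` p'))"
            by (rule content_division[OF div])
          also have "\<dots> \<le> measure lebesgue U"
          proof (rule measure_mono_fmeasurable[OF _ _ Um])
            show "\<Union> (snd ` p') \<subseteq> U"
            proof (rule Union_least)
              fix K assume "K \<in> snd ` p'"
              then obtain x where "(x,K) \<in> p" "x \<in> N" by (auto simp: p'_def)
              with pK[of x K] d(3)[of x] show "K \<subseteq> U" by blast
            qed
            show "\<Union> (snd ` p') \<in> sets lebesgue"
              using lmeasurable_division[OF div] by (rule fmeasurableD)
          qed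
          also have "\<dots> < \<delta>" by (rule mU)
          finally show "(\<Sum>k\<in>snd ` p'. Sup k - Inf k) < \<delta>" .
        qed
        finally show ?thesis .
      qed
      have incr: "norm (measure lborel K *\<^sub>R g' x - (f (Sup K) - f (Inf K))) \<le> e / 2 * (Sup K - Inf K)"
        if "(x,K) \<in> p - p'" for x K
      proof -
        have "x \<notin> N" "(x,K) \<in> p" using that by (auto simp: p'_def)
        from pK[OF this(2)] obtain u v where k: "K = {u..v}" "u \<le> v" "x \<in> K" "K \<subseteq> {a..b}"
          "K \<subseteq> ball x (d x)" by blast
        have "u \<in> ball x (d x)" "v \<in> ball x (d x)" "u \<in> {a..b}" "v \<in> {a..b}"
          using k(2) subsetD[OF k(5)[unfolded k(1)]] subsetD[OF k(4)[unfolded k(1)]]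
          by (auto simp del: mem_ball)
        then have u: "u \<in> {a..b}" "norm (u - x) < d x" and v: "v \<in> {a..b}" "norm (v - x) < d x"
          by (simp_all add: dist_real_def abs_minus_commute)
        have x: "x \<in> {a..b} - N" using k \<open>x \<notin> N\<close> by auto
        have "norm ((v - u) *\<^sub>R g x - (f v - f u)) = norm (f u - f x - (u - x) *\<^sub>R g x - (f v - f x - (v - x) *\<^sub>R g x))"
          by (auto simp: algebra_simps)
        also have "\<dots> \<le> norm (f u - f x - (u - x) *\<^sub>R g x) + norm (f v - f x - (v - x) *\<^sub>R g x)"
          by (rule norm_triangle_ineq4)
        also have "\<dots> \<le> e / 2 * norm (u - x) + e / 2 * norm (v - x)"
          by (intro add_mono d(2) x u v)
        also have "\<dots> = e / 2 * (v - u)" using k by (auto simp: field_simps)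
        finally show ?thesis using k \<open>x \<notin> N\<close> by (simp add: g'_def)
      qed
      have "norm ((\<Sum>(x, k)\<in>p. measure lborel k *\<^sub>R g' x) - (f b - f a))
          = norm (\<Sum>(x, K) \<in> p. (measure lborel K *\<^sub>R g' x) - (f (Sup K) - f (Inf K)))"
        by (simp add: ba split_def sum_subtractf)
      also have "\<dots> = norm ((\<Sum>(x, K) \<in> p - p'. (measure lborel K *\<^sub>R g' x) - (f (Sup K) - f (Inf K)))
           + (\<Sum>(x, K) \<in> p'. (measure lborel K *\<^sub>R g' x) - (f (Sup K) - f (Inf K))))"
        by (simp only: sum.subset_diff[OF \<open>p' \<subseteq> p\<close> \<open>finite p\<close>])
      also have "\<dots> \<le> (\<Sum>(x, K) \<in> p - p'. e / 2 * (Sup K - Inf K)) + (\<Sum>(x, K) \<in> p'. norm (f (Sup K) - f (Inf K)))"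
      proof (rule norm_triangle_le[OF add_mono])
        show "norm (\<Sum>(x, K) \<in> p - p'. (measure lborel K *\<^sub>R g' x) - (f (Sup K) - f (Inf K)))
           \<le> (\<Sum>(x, K) \<in> p - p'. e / 2 * (Sup K - Inf K))"
          using incr by (intro sum_norm_le) auto
        show "norm (\<Sum>(x, K) \<in> p'. (measure lborel K *\<^sub>R g' x) - (f (Sup K) - f (Inf K)))
           \<le> (\<Sum>(x, K) \<in> p'. norm (f (Sup K) - f (Inf K)))"
          by (intro sum_norm_le) (auto simp: p'_def g'_def norm_minus_commute)
      qed
      also have "(\<Sum>(x, K) \<in> p - p'. e / 2 * (Sup K - Inf K)) \<le> (\<Sum>(x, K) \<in> p. e / 2 * (Sup K - Inf K))"
      proof (rule sum_mono2[OF \<open>finite p\<close>])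
        fix z assume "z \<in> p - (p - p')"
        then obtain x K where z: "z = (x,K)" "(x,K) \<in> p" by (cases z) auto
        with pK[of x K] \<open>e > 0\<close> show "0 \<le> (case z of (x, K) \<Rightarrow> e / 2 * (Sup K - Inf K))" by auto
      qed auto
      also have "(\<Sum>(x, K) \<in> p. e / 2 * (Sup K - Inf K)) = e / 2 * (b - a)"
        by (simp add: ba sum_distrib_left split_def)
      finally show "norm ((\<Sum>(x, k)\<in>p. measure lborel k *\<^sub>R g' x) - (f b - f a)) \<le> e * measure lborel {a..b}"
        using sum' \<open>a < b\<close> by (simp add: field_simps)
    qed
  qed
  then show ?thesis
    by (rule has_integral_spike[OF N, rotated]) (auto simp: g'_def)
qed

text \<open>A substitute for "zero derivative implies constant" when no derivative is at hand: on a
  fine uniform mesh the increments telescope to at most \<epsilon> times the total increment of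
  \<open>G\<close>. In the application \<open>G\<close> is the integral of the speed.\<close>

lemma const_of_dominated_increments:
  fixes \<phi> :: "real \<Rightarrow> 'a::real_normed_vector" and G :: "real \<Rightarrow> real"
  assumes "0 \<le> T" and inc: "\<And>\<epsilon>. \<epsilon> > 0 \<Longrightarrow> \<exists>\<delta>>0. \<forall>a b. 0 \<le> a \<and> a \<le> b \<and> b \<le> T \<and> b - a < \<delta> \<longrightarrow>
             norm (\<phi> b - \<phi> a) \<le> \<epsilon> * (G b - G a)"
  shows "\<phi> T = \<phi> 0"
proof -
  have bound: "norm (\<phi> T - \<phi> 0) \<le> \<epsilon> * (G T - G 0)" if "\<epsilon> > 0" for \<epsilon>
  proof -
    obtain \<delta> where "\<delta> > 0" and \<delta>: "\<And>a b. 0 \<le> a \<Longrightarrow> a \<le> b \<Longrightarrow> b \<le> T \<Longrightarrow> b - a < \<delta> \<Longrightarrow>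
             norm (\<phi> b - \<phi> a) \<le> \<epsilon> * (G b - G a)"
      using inc[OF \<open>\<epsilon> > 0\<close>] by metis
    obtain n :: nat where n: "T / \<delta> < real n" using reals_Archimedean2 by blast
    have "n > 0" using n \<open>0 \<le> T\<close> \<open>\<delta> > 0\<close> by (cases n) (auto simp: field_simps)
    define t where "t i = real i * (T / n)" for i
    have t0: "t 0 = 0" and tn: "t n = T" using \<open>n > 0\<close> by (auto simp: t_def)
    have tS: "t (Suc i) - t i = T / n" for i by (simp add: t_def algebra_simps add_divide_distrib)
    have small: "T / n < \<delta>" using n \<open>n > 0\<close> \<open>\<delta> > 0\<close> by (simp add: field_simps)
    have "norm (\<phi> T - \<phi> 0) = norm (\<Sum>i<n. \<phi> (t (Suc i)) - \<phi> (t i))"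
      using sum_lessThan_telescope[of "\<lambda>i. \<phi> (t i)" n] by (simp add: t0 tn)
    also have "\<dots> \<le> (\<Sum>i<n. \<epsilon> * (G (t (Suc i)) - G (t i)))"
    proof (rule sum_norm_le)
      fix i assume "i \<in> {..<n}"
      then have "t (Suc i) \<le> t n" unfolding t_def using \<open>0 \<le> T\<close> by (intro mult_right_mono) auto
      then show "norm (\<phi> (t (Suc i)) - \<phi> (t i)) \<le> \<epsilon> * (G (t (Suc i)) - G (t i))"
        using tS[of i] small divide_nonneg_nonneg[OF \<open>0 \<le> T\<close>, of n] \<open>0 \<le> T\<close> tn
        by (intro \<delta>) (linarith | simp add: t_def)+
    qed
    also have "\<dots> = \<epsilon> * (G T - G 0)"
      using sum_lessThan_telescope[of "\<lambda>i. G (t i)" n] by (simp add: t0 tn sum_distrib_left[symmetric])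
    finally show ?thesis .
  qed
  have "norm (\<phi> T - \<phi> 0) \<le> 0"
  proof (rule field_le_epsilon)
    fix e :: real assume "e > 0"
    have "norm (\<phi> T - \<phi> 0) \<le> e / (\<bar>G T - G 0\<bar> + 1) * (G T - G 0)"
      using \<open>e > 0\<close> by (intro bound) (auto intro: divide_pos_pos add_nonneg_pos)
    also have "\<dots> \<le> e / (\<bar>G T - G 0\<bar> + 1) * (\<bar>G T - G 0\<bar> + 1)"
      using \<open>e > 0\<close> by (intro mult_left_mono) auto
    also have "\<dots> = e" by (auto simp: add_nonneg_eq_0_iff)
    finally show "norm (\<phi> T - \<phi> 0) \<le> 0 + e" by simp
  qed
  then show ?thesis by simp
qed

text \<open>The solution is the exponential series with terms
  \<open>t ^ k *\<^sub>R (f ^^ k) z /\<^sub>R fact k\<close>, dominated by a scalar exponential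
  series.\<close>

lemma linear_ode_exists:
  fixes f :: "'a::euclidean_space \<Rightarrow> 'a"
  assumes "linear f"
  shows "\<exists>y. y 0 = z \<and> (\<forall>t. (y has_vector_derivative f (y t)) (at t))"
proof -
  have "bounded_linear f" using assms linear_conv_bounded_linear by blast
  then obtain K where "K > 0" and K: "\<And>x. norm (f x) \<le> norm x * K"
    using bounded_linear.pos_bounded by blast
  define c where "c k = (f ^^ k) z /\<^sub>R fact k" for k
  have nb: "norm ((f ^^ k) z) \<le> K ^ k * norm z" for k
  proof (induction k)
    case (Suc k)
    have "norm (f ((f ^^ k) z)) \<le> norm ((f ^^ k) z) * K" by (rule K)
    also have "\<dots> \<le> (K ^ k * norm z) * K" using Suc \<open>K > 0\<close> by (intro mult_right_mono) auto
    finally show ?case by (simp add: mult_ac)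
  qed auto
  have cS: "real (Suc k) *\<^sub>R c (Suc k) = f (c k)" for k
    using assms by (simp add: c_def linear_scale del: of_nat_Suc)
  have summ: "summable (\<lambda>k. t ^ k *\<^sub>R c k)" for t
  proof (rule summable_comparison_test)
    show "summable (\<lambda>k. norm z * (inverse (fact k) * (K * \<bar>t\<bar>) ^ k))"
      by (intro summable_mult summable_exp)
    have "norm (t ^ k *\<^sub>R c k) \<le> norm z * (inverse (fact k) * (K * \<bar>t\<bar>) ^ k)" for k
    proof -
      have "norm (t ^ k *\<^sub>R c k) = \<bar>t\<bar> ^ k * (inverse (fact k) * norm ((f ^^ k) z))"
        by (simp add: c_def power_abs abs_mult)
      also have "\<dots> \<le> \<bar>t\<bar> ^ k * (inverse (fact k) * (K ^ k * norm z))"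
        by (intro mult_left_mono nb) auto
      finally show ?thesis by (simp add: power_mult_distrib mult_ac)
    qed
    then show "\<exists>N. \<forall>n\<ge>N. norm (t ^ n *\<^sub>R c n) \<le> norm z * (inverse (fact n) * (K * \<bar>t\<bar>) ^ n)"
      by blast
  qed
  define y where "y t = (\<Sum>k. t ^ k *\<^sub>R c k)" for t
  have suminf_lin: "(\<lambda>k. t ^ k *\<^sub>R g (c k)) sums g (y t)" if "bounded_linear g" for g :: "'a \<Rightarrow> 'b::real_normed_vector" and t
    using bounded_linear.sums[OF that, OF summable_sums[OF summ[of t]]]
      bounded_linear.linear[OF that] by (simp add: y_def linear_scale)
  have comp: "(\<lambda>k. (c k \<bullet> b) * t ^ k) sums (y t \<bullet> b)" for b t
    using suminf_lin[OF bounded_linear_inner_left, of t b] by (simp add: mult.commute)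
  have compf: "(\<lambda>k. (f (c k) \<bullet> b) * t ^ k) sums (f (y t) \<bullet> b)" for b t
    using suminf_lin[OF bounded_linear_compose[OF bounded_linear_inner_left \<open>bounded_linear f\<close>], of t b]
    by (simp add: mult.commute)
  \<comment> \<open>Termwise differentiation is done for the real power series of each coordinate;
    shifting its coefficients amounts to applying \<open>f\<close>.\<close>
  have diffs: "diffs (\<lambda>k. c k \<bullet> b) = (\<lambda>k. f (c k) \<bullet> b)" for b
    by (simp add: diffs_def fun_eq_iff cS[symmetric] del: of_nat_Suc)
  have "((\<lambda>t. y t \<bullet> b) has_field_derivative f (y t) \<bullet> b) (at t)" for b t
  proof -
    have "((\<lambda>t. \<Sum>k. (c k \<bullet> b) * t ^ k) has_field_derivative (\<Sum>k. diffs (\<lambda>k. c k \<bullet> b) k * t ^ k)) (at t)"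
      by (rule termdiffs_strong_converges_everywhere) (use comp sums_summable in blast)
    then show ?thesis
      using sums_unique[OF comp] sums_unique[OF compf] by (simp add: diffs)
  qed
  then have "(y has_vector_derivative f (y t)) (at t)" for t
    unfolding has_vector_derivative_def has_derivative_componentwise_within[of y]
    by (auto simp: has_field_derivative_def mult_commute_abs)
  moreover have "y 0 = z"
    using suminf_finite[of "{0}" "\<lambda>k. 0 ^ k *\<^sub>R c k"] by (simp add: y_def c_def power_0_left)
  ultimately show ?thesis by blast
qed

section \<open>Trajectories of a linear control system\<close>

lemma matrix_vector_inner_transpose: "(M *v x) \<bullet> y = x \<bullet> (transpose M *v y)"
  for M :: "real^'n^'m"
  by (metis dot_lmul_matrix inner_commute transpose_matrix_vector transpose_transpose)

lemma matrix_vector_norm_bound: "\<exists>K>0. \<forall>x. norm (M *v x) \<le> K * norm x"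
  for M :: "real^'n^'m"
  using bounded_linear.pos_bounded[OF matrix_vector_mul_bounded_linear[of M]] by (auto simp: mult.commute)

lemma matrix_vector_inner_bound: "\<exists>K>0. \<forall>x y. \<bar>(M *v x) \<bullet> y\<bar> \<le> K * (norm x * norm y)"
  for M :: "real^'n^'m"
proof -
  obtain K where "K > 0" and K: "\<And>x. norm (M *v x) \<le> K * norm x"
    using matrix_vector_norm_bound[of M] by blast
  have "\<bar>(M *v x) \<bullet> y\<bar> \<le> K * (norm x * norm y)" for x y
  proof -
    have "\<bar>(M *v x) \<bullet> y\<bar> \<le> norm (M *v x) * norm y" by (rule Cauchy_Schwarz_ineq2)
    also have "\<dots> \<le> (K * norm x) * norm y" by (intro mult_right_mono K) auto
    finally show ?thesis by (simp add: mult_ac)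
  qed
  with \<open>K > 0\<close> show ?thesis by blast
qed

text \<open>\<open>l\<close> is the minimum of the form on the unit sphere, attained by compactness;
  homogeneity extends the bound to all vectors.\<close>

lemma sym_pos_def_coercive:
  fixes M :: "real^'n^'n"
  assumes "sym_pos_def M"
  shows "\<exists>l>0. \<forall>x. l * (norm x)\<^sup>2 \<le> (M *v x) \<bullet> x"
proof -
  have "compact (sphere (0::real^'n) 1)" "sphere (0::real^'n) 1 \<noteq> {}" by auto
  moreover have "continuous_on (sphere 0 1) (\<lambda>x. (M *v x) \<bullet> x)"
    by (intro continuous_intros linear_continuous_on matrix_vector_mul_bounded_linear)
  ultimately obtain z where z: "z \<in> sphere 0 1" and le: "\<And>x. x \<in> sphere 0 1 \<Longrightarrow> (M *v z) \<bullet> z \<le> (M *v x) \<bullet> x"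
    using continuous_attains_inf by meson
  define l where "l = (M *v z) \<bullet> z"
  have "z \<noteq> 0" using z by auto
  then have "l > 0" using assms by (simp add: sym_pos_def_def l_def)
  moreover have "l * (norm x)\<^sup>2 \<le> (M *v x) \<bullet> x" for x
  proof (cases "x = 0")
    case False
    define y where "y = x /\<^sub>R norm x"
    have x: "x = norm x *\<^sub>R y" using False by (simp add: y_def)
    have "l \<le> (M *v y) \<bullet> y" using le[of y] False by (simp add: l_def y_def)
    then have "(norm x)\<^sup>2 * l \<le> (norm x)\<^sup>2 * ((M *v y) \<bullet> y)" by (intro mult_left_mono) auto
    also have "\<dots> = (M *v (norm x *\<^sub>R y)) \<bullet> (norm x *\<^sub>R y)"
      by (simp add: matrix_vector_mult_scaleR power2_eq_square)
    also have "\<dots> = (M *v x) \<bullet> x" by (simp flip: x)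
    finally show ?thesis by (simp add: mult.commute)
  qed auto
  ultimately show ?thesis by blast
qed

lemma symmetric_matrix_inner:
  "transpose M = M \<Longrightarrow> (M *v y) \<bullet> x = (M *v x) \<bullet> y" for M :: "real^'n^'n"
  using matrix_vector_inner_transpose[of M y x] by (simp add: inner_commute)

text \<open>Polarization: for a symmetric matrix the quadratic form determines the bilinear
  form.\<close>

lemma symmetric_matrix_eqI:
  fixes M N :: "real^'n^'n"
  assumes "transpose M = M" "transpose N = N" and eq: "\<And>x. (M *v x) \<bullet> x = (N *v x) \<bullet> x"
  shows "M = N"
proof -
  have symM: "(M *v y) \<bullet> x = (M *v x) \<bullet> y" and symN: "(N *v y) \<bullet> x = (N *v x) \<bullet> y" for x y
    using assms(1,2) symmetric_matrix_inner by blast+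
  have "(M *v x) \<bullet> y = (N *v x) \<bullet> y" for x y
    using eq[of "x + y"] eq[of x] eq[of y] symM[of x y] symN[of x y]
    by (simp add: matrix_vector_right_distrib inner_add_left inner_add_right)
  then have "M *v x = N *v x" for x by (metis vector_eq_rdot)
  then show ?thesis by (simp add: matrix_eq)
qed

lemma borel_measurable_matrix_vector:
  fixes M :: "real^'n^'m"
  assumes "u \<in> borel_measurable S"
  shows "(\<lambda>t. M *v u t) \<in> borel_measurable S"
  by (rule borel_measurable_continuous_on[OF _ assms])
     (intro linear_continuous_on matrix_vector_mul_bounded_linear)

text \<open>The integral form of the differential equation with a locally square integrable control.
  It implies continuity of \<open>x\<close>, is insensitive to null sets, and passes to shifts,
  concatenations and linear combinations. Square integrability makes the cost on bounded intervals
  finite.\<close>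

definition control_traj :: "real^'n^'n \<Rightarrow> real^'m^'n \<Rightarrow> (real \<Rightarrow> real^'n) \<Rightarrow> (real \<Rightarrow> real^'m) \<Rightarrow> bool" where
  "control_traj A B x u \<longleftrightarrow> (\<forall>T\<ge>0. u integrable_on {0..T} \<and> (\<lambda>t. (norm (u t))\<^sup>2) integrable_on {0..T} \<and>
     ((\<lambda>t. A *v x t + B *v u t) has_integral (x T - x 0)) {0..T})"

context
  fixes A :: "real^'n^'n" and B :: "real^'m^'n" and x u
  assumes traj: "control_traj A B x u"
begin

lemma control_traj_measurable: "u \<in> borel_measurable (lebesgue_on {0..T})"
  using traj integrable_imp_measurable[of u "{0..T}"]
  by (cases "T \<ge> 0") (auto simp: control_traj_def intro: integrable_imp_measurable)

lemma control_traj_continuous: "continuous_on {0..T} x"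
proof (cases "T \<ge> 0")
  case True
  let ?g = "\<lambda>t. A *v x t + B *v u t"
  have "?g integrable_on {0..T}" using traj True unfolding control_traj_def by blast
  then have "continuous_on {0..T} (\<lambda>t. x 0 + integral {0..t} ?g)"
    by (intro continuous_intros indefinite_integral_continuous_1)
  moreover have "x 0 + integral {0..t} ?g = x t" if "t \<in> {0..T}" for t
  proof -
    have "(?g has_integral (x t - x 0)) {0..t}" using traj that unfolding control_traj_def by simp
    then show ?thesis by (simp add: integral_unique)
  qed
  ultimately show ?thesis by (rule continuous_on_eq)
qed auto

lemma control_traj_measurable_state: "x \<in> borel_measurable (lebesgue_on {0..T})"
  using control_traj_continuous by (intro continuous_imp_measurable_on_sets_lebesgue) auto

lemma control_traj_abs_integrable: "u absolutely_integrable_on {0..T}"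
proof (cases "T \<ge> 0")
  case True
  show ?thesis
  proof (rule measurable_bounded_by_integrable_imp_absolutely_integrable[OF control_traj_measurable])
    show "(\<lambda>t. 1 + (norm (u t))\<^sup>2) integrable_on {0..T}"
      using traj True unfolding control_traj_def by (intro integrable_add) auto
    show "norm (u t) \<le> 1 + (norm (u t))\<^sup>2" for t
      using zero_le_power2[of "norm (u t) - 1/2"] by (simp add: power2_eq_square algebra_simps)
  qed auto
qed auto

lemma control_traj_deriv_abs_integrable: "(\<lambda>t. A *v x t + B *v u t) absolutely_integrable_on {0..T}"
proof (rule set_integral_add)
  show "(\<lambda>t. A *v x t) absolutely_integrable_on {0..T}"
    by (intro absolutely_integrable_continuous_real
        bounded_linear.continuous_on[OF matrix_vector_mul_bounded_linear control_traj_continuous])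
  show "(\<lambda>t. B *v u t) absolutely_integrable_on {0..T}"
    using absolutely_integrable_linear[OF control_traj_abs_integrable matrix_vector_mul_bounded_linear, of T B]
    by (simp add: o_def)
qed

lemma control_traj_increment:
  assumes "0 \<le> a" "a \<le> b"
  shows "((\<lambda>t. A *v x t + B *v u t) has_integral (x b - x a)) {a..b}"
proof -
  let ?g = "\<lambda>t. A *v x t + B *v u t"
  have a: "(?g has_integral (x a - x 0)) {0..a}" and b: "(?g has_integral (x b - x 0)) {0..b}"
    using traj assms unfolding control_traj_def by auto
  have "?g integrable_on {a..b}"
    using has_integral_integrable[OF b] assms by (auto elim!: integrable_on_subinterval)
  then have "(?g has_integral (x a - x 0) + integral {a..b} ?g) {0..b}"
    using assms a by (intro has_integral_combine[OF _ _ a]) auto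
  then have "(x a - x 0) + integral {a..b} ?g = x b - x 0" using b has_integral_unique by blast
  then have "integral {a..b} ?g = x b - x a" by (simp add: algebra_simps)
  with integrable_integral[OF \<open>?g integrable_on {a..b}\<close>] show ?thesis by simp
qed

text \<open>\<open>x\<close> is not assumed differentiable anywhere, so the increments of the two sides are compared
  over short intervals.\<close>
lemma control_traj_quadratic:
  assumes "0 \<le> T" and E: "transpose E = E"
  shows "((\<lambda>t. 2 * ((E *v x t) \<bullet> (A *v x t + B *v u t))) has_integral
          ((E *v x T) \<bullet> x T - (E *v x 0) \<bullet> x 0)) {0..T}"
proof -
  let ?g = "\<lambda>t. A *v x t + B *v u t"
  let ?w = "\<lambda>t. 2 * ((E *v x t) \<bullet> ?g t)"
  obtain K where "K > 0" and K: "\<And>x y. \<bar>(E *v x) \<bullet> y\<bar> \<le> K * (norm x * norm y)"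
    using matrix_vector_inner_bound[of E] by blast
  have gn: "(\<lambda>t. norm (?g t)) integrable_on {a..b}" if "0 \<le> a" "b \<le> T" for a b
    using control_traj_deriv_abs_integrable[of T] that
    unfolding absolutely_integrable_on_def
    by (intro integrable_on_subinterval[of "\<lambda>t. norm (?g t)" "{0..T}" a b]) auto
  have "bounded (x ` {0..T})"
    using control_traj_continuous by (intro compact_imp_bounded compact_continuous_image) auto
  then obtain C where C: "\<And>t. t \<in> {0..T} \<Longrightarrow> norm (x t) \<le> C"
    unfolding bounded_iff by (meson imageI)
  have wint: "?w integrable_on {0..T}"
  proof (rule measurable_bounded_by_integrable_imp_integrable)
    show "?w \<in> borel_measurable (lebesgue_on {0..T})"
      by (intro borel_measurable_times borel_measurable_const borel_measurable_inner borel_measurable_add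
          borel_measurable_matrix_vector control_traj_measurable control_traj_measurable_state)
    show "(\<lambda>t. 2 * K * C * norm (?g t)) integrable_on {0..T}"
      using gn[of 0 T] by (intro integrable_on_mult_right) auto
    fix t assume t: "t \<in> {0..T}"
    have "\<bar>(E *v x t) \<bullet> ?g t\<bar> \<le> K * (norm (x t) * norm (?g t))" by (rule K)
    also have "\<dots> \<le> K * (C * norm (?g t))"
      using C[OF t] \<open>K > 0\<close> by (intro mult_left_mono mult_right_mono) auto
    finally show "norm (?w t) \<le> 2 * K * C * norm (?g t)" by (simp add: abs_mult)
  qed auto
  define \<phi> where "\<phi> t = (E *v x t) \<bullet> x t - integral {0..t} ?w" for t
  define G where "G t = integral {0..t} (\<lambda>t. norm (?g t))" for t
  have uc: "uniformly_continuous_on {0..T} x"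
    using control_traj_continuous by (intro compact_uniformly_continuous) auto
  have "\<phi> T = \<phi> 0"
  proof (rule const_of_dominated_increments[where G = G, OF \<open>0 \<le> T\<close>])
    fix \<epsilon> :: real assume "\<epsilon> > 0"
    then have "\<epsilon> / (2 * K) > 0" using \<open>K > 0\<close> by simp
    then obtain \<delta> where "\<delta> > 0" and \<delta>: "\<And>s t. s \<in> {0..T} \<Longrightarrow> t \<in> {0..T} \<Longrightarrow> dist s t < \<delta> \<Longrightarrow> dist (x s) (x t) < \<epsilon> / (2 * K)"
      using uc unfolding uniformly_continuous_on_def by (metis dist_commute)
    have "norm (\<phi> b - \<phi> a) \<le> \<epsilon> * (G b - G a)" if ab: "0 \<le> a" "a \<le> b" "b \<le> T" "b - a < \<delta>" for a b
    proof -
      \<comment> \<open>By symmetry of \<open>E\<close>, pairing \<open>E *v (x a + x b)\<close>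
        with \<open>x b - x a\<close> gives exactly the increment of the quadratic form. The only
        error is then the replacement of \<open>2 *\<^sub>R x t\<close> by \<open>v\<close>, which
        uniform continuity of \<open>x\<close> makes small.\<close>
      define v where "v = x a + x b"
      note symE = symmetric_matrix_inner[OF E]
      have hi: "(?g has_integral (x b - x a)) {a..b}" using control_traj_increment ab by auto
      have wab: "?w integrable_on {a..b}" and wb: "?w integrable_on {0..b}" and wa: "?w integrable_on {0..a}"
        using wint ab by (auto elim!: integrable_on_subinterval)
      have 1: "((\<lambda>t. (E *v v) \<bullet> ?g t) has_integral (E *v v) \<bullet> (x b - x a)) {a..b}"
        using has_integral_linear[OF hi bounded_linear_inner_right] by (simp add: o_def)
      have 2: "(E *v v) \<bullet> (x b - x a) = (E *v x b) \<bullet> x b - (E *v x a) \<bullet> x a"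
        using symE[of "x a" "x b"]
        by (simp add: v_def matrix_vector_right_distrib inner_add_left inner_diff_right)
      have comb: "integral {0..a} ?w + integral {a..b} ?w = integral {0..b} ?w"
        using ab by (intro Henstock_Kurzweil_Integration.integral_combine wb)
      have eq: "\<phi> b - \<phi> a = integral {a..b} (\<lambda>t. (E *v v) \<bullet> ?g t - ?w t)"
        using 1 2 comb wab unfolding \<phi>_def
        by (subst Henstock_Kurzweil_Integration.integral_diff) (auto simp: integral_unique)
      have "norm (integral {a..b} (\<lambda>t. (E *v v) \<bullet> ?g t - ?w t)) \<le> integral {a..b} (\<lambda>t. \<epsilon> * norm (?g t))"
      proof (rule Henstock_Kurzweil_Integration.integral_norm_bound_integral)
        show "(\<lambda>t. (E *v v) \<bullet> ?g t - ?w t) integrable_on {a..b}"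
          using 1 wab by (intro integrable_diff) auto
        show "(\<lambda>t. \<epsilon> * norm (?g t)) integrable_on {a..b}"
          using gn[of a b] ab by (intro integrable_on_mult_right) auto
        fix t assume t: "t \<in> {a..b}"
        have "norm (v - 2 *\<^sub>R x t) \<le> norm (x a - x t) + norm (x b - x t)"
          unfolding v_def by (rule order_trans[OF _ norm_triangle_ineq]) (simp add: scaleR_2 algebra_simps)
        also have "\<dots> \<le> \<epsilon> / (2 * K) + \<epsilon> / (2 * K)"
          using \<delta>[of a t] \<delta>[of b t] t ab by (intro add_mono) (auto simp: dist_norm)
        finally have vn: "norm (v - 2 *\<^sub>R x t) \<le> \<epsilon> / K" by simp
        have "(E *v v) \<bullet> ?g t - ?w t = (E *v (v - 2 *\<^sub>R x t)) \<bullet> ?g t"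
          by (simp add: matrix_vector_mult_diff_distrib matrix_vector_mult_scaleR inner_diff_left)
        also have "\<bar>\<dots>\<bar> \<le> K * (norm (v - 2 *\<^sub>R x t) * norm (?g t))" by (rule K)
        also have "\<dots> \<le> K * (\<epsilon> / K * norm (?g t))"
          using vn \<open>K > 0\<close> by (intro mult_left_mono mult_right_mono) auto
        finally show "norm ((E *v v) \<bullet> ?g t - ?w t) \<le> \<epsilon> * norm (?g t)" using \<open>K > 0\<close> by simp
      qed
      also have "\<dots> = \<epsilon> * (G b - G a)"
        using Henstock_Kurzweil_Integration.integral_combine[OF \<open>0 \<le> a\<close> \<open>a \<le> b\<close> gn[of 0 b]] ab
        by (simp add: G_def)
      finally show ?thesis by (simp add: eq)
    qed
    with \<open>\<delta> > 0\<close> show "\<exists>\<delta>>0. \<forall>a b. 0 \<le> a \<and> a \<le> b \<and> b \<le> T \<and> b - a < \<delta> \<longrightarrow> norm (\<phi> b - \<phi> a) \<le> \<epsilon> * (G b - G a)"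
      by blast
  qed
  then have "integral {0..T} ?w = (E *v x T) \<bullet> x T - (E *v x 0) \<bullet> x 0" by (simp add: \<phi>_def)
  with integrable_integral[OF wint] show ?thesis by simp
qed

lemma control_traj_shift:
  assumes "0 \<le> s"
  shows "control_traj A B (\<lambda>t. x (t + s)) (\<lambda>t. u (t + s))"
  unfolding control_traj_def
proof (intro allI impI conjI)
  fix T :: real assume "0 \<le> T"
  have sub: "f integrable_on {0..T+s} \<Longrightarrow> (\<lambda>t. f (t + s)) integrable_on {0..T}" for f :: "real \<Rightarrow> 'c::banach"
    using integrable_shift_real_ivl[of f s "T+s" s] integrable_on_subinterval[of f "{0..T+s}" s "T+s"] \<open>0 \<le> s\<close> by simp
  show "(\<lambda>t. u (t + s)) integrable_on {0..T}"
    using traj \<open>0 \<le> T\<close> \<open>0 \<le> s\<close> by (intro sub) (simp add: control_traj_def)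
  show "(\<lambda>t. (norm (u (t + s)))\<^sup>2) integrable_on {0..T}"
    using traj \<open>0 \<le> T\<close> \<open>0 \<le> s\<close> by (intro sub[of "\<lambda>t. (norm (u t))\<^sup>2"]) (simp add: control_traj_def)
  show "((\<lambda>t. A *v x (t + s) + B *v u (t + s)) has_integral x (T + s) - x (0 + s)) {0..T}"
    using has_integral_shift_real_ivl[OF control_traj_increment[of s "T + s"], of s] \<open>0 \<le> T\<close> \<open>0 \<le> s\<close> by simp
qed

end

lemma control_traj_lincomb:
  assumes "control_traj A B x u" "control_traj A B y v"
  shows "control_traj A B (\<lambda>t. a *\<^sub>R x t + b *\<^sub>R y t) (\<lambda>t. a *\<^sub>R u t + b *\<^sub>R v t)"
  unfolding control_traj_def
proof (intro allI impI conjI)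
  fix T :: real assume "0 \<le> T"
  note ui = assms[unfolded control_traj_def, rule_format, OF \<open>0 \<le> T\<close>]
  show int: "(\<lambda>t. a *\<^sub>R u t + b *\<^sub>R v t) integrable_on {0..T}"
    using ui by (intro integrable_add integrable_cmul) auto
  show "(\<lambda>t. (norm (a *\<^sub>R u t + b *\<^sub>R v t))\<^sup>2) integrable_on {0..T}"
  proof (rule measurable_bounded_by_integrable_imp_integrable)
    show "(\<lambda>t. (norm (a *\<^sub>R u t + b *\<^sub>R v t))\<^sup>2) \<in> borel_measurable (lebesgue_on {0..T})"
      using integrable_imp_measurable[OF int] by measurable
    show "(\<lambda>t. 2 * a\<^sup>2 * (norm (u t))\<^sup>2 + 2 * b\<^sup>2 * (norm (v t))\<^sup>2) integrable_on {0..T}"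
      using ui by (intro integrable_add integrable_on_mult_right) auto
    fix t
    have "(norm (a *\<^sub>R u t + b *\<^sub>R v t))\<^sup>2 \<le> (norm (a *\<^sub>R u t) + norm (b *\<^sub>R v t))\<^sup>2"
      by (intro power_mono norm_triangle_ineq) auto
    also have "\<dots> \<le> 2 * (norm (a *\<^sub>R u t))\<^sup>2 + 2 * (norm (b *\<^sub>R v t))\<^sup>2"
      using zero_le_power2[of "norm (a *\<^sub>R u t) - norm (b *\<^sub>R v t)"] by (simp add: power2_eq_square algebra_simps)
    finally show "norm ((norm (a *\<^sub>R u t + b *\<^sub>R v t))\<^sup>2) \<le> 2 * a\<^sup>2 * (norm (u t))\<^sup>2 + 2 * b\<^sup>2 * (norm (v t))\<^sup>2"
      by (simp add: power_mult_distrib)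
  qed auto
  have "((\<lambda>t. a *\<^sub>R (A *v x t + B *v u t) + b *\<^sub>R (A *v y t + B *v v t)) has_integral
     (a *\<^sub>R (x T - x 0) + b *\<^sub>R (y T - y 0))) {0..T}"
    using ui by (intro has_integral_add has_integral_cmul) auto
  then show "((\<lambda>t. A *v (a *\<^sub>R x t + b *\<^sub>R y t) + B *v (a *\<^sub>R u t + b *\<^sub>R v t)) has_integral
     a *\<^sub>R x T + b *\<^sub>R y T - (a *\<^sub>R x 0 + b *\<^sub>R y 0)) {0..T}"
    by (simp add: matrix_vector_right_distrib matrix_vector_mult_scaleR algebra_simps)
qed

text \<open>The \<open>min T h\<close> and the guarded assumption on \<open>g\<close> let one
  statement serve horizons before and after the junction, as \<open>control_traj\<close> asks for
  every horizon.\<close>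

lemma has_integral_concat:
  fixes f g :: "real \<Rightarrow> 'a::banach"
  assumes h: "0 \<le> h" and f: "(f has_integral i) {0..min T h}"
    and g: "h \<le> T \<Longrightarrow> (g has_integral j) {0..T-h}"
  shows "((\<lambda>t. if t \<le> h then f t else g (t - h)) has_integral (if T \<le> h then i else i + j)) {0..T}"
proof (cases "T \<le> h")
  case True
  then have "((\<lambda>t. if t \<le> h then f t else g (t - h)) has_integral i) {0..T}"
    using f by (intro has_integral_eq[OF _ f[unfolded min_absorb1[OF True]]]) auto
  then show ?thesis using True by simp
next
  case False
  then have "((\<lambda>t. g (t - h)) has_integral j) {h..T}"
    using has_integral_shift_real_ivl[of g j 0 "T-h" "-h"] g by simp
  then have "((\<lambda>t. if t \<le> h then f t else g (t - h)) has_integral j) {h..T}"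
    by (rule has_integral_spike[OF negligible_sing[of h], rotated 1]) auto
  moreover have "((\<lambda>t. if t \<le> h then f t else g (t - h)) has_integral i) {0..h}"
    by (rule has_integral_eq[of "{0..h}" f]) (use False f in \<open>auto simp: min_def split: if_splits\<close>)
  ultimately show ?thesis using False h by (simp add: has_integral_combine[of 0 h T])
qed

lemma control_traj_concat:
  assumes h: "0 \<le> h" and x: "control_traj A B x u" and y: "control_traj A B y v" and "x h = y 0"
  shows "control_traj A B (\<lambda>t. if t \<le> h then x t else y (t - h)) (\<lambda>t. if t \<le> h then u t else v (t - h))"
    (is "control_traj A B ?z ?w")
  unfolding control_traj_def
proof (intro allI impI conjI)
  fix T :: real assume "0 \<le> T"
  have mT: "0 \<le> min T h" using h \<open>0 \<le> T\<close> by simp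
  note ui = x[unfolded control_traj_def, rule_format, OF mT] y[unfolded control_traj_def, rule_format, of "T - h"]
  have conc: "(\<lambda>t. if t \<le> h then f t else g (t - h)) integrable_on {0..T}"
    if f: "f integrable_on {0..min T h}" and g: "h \<le> T \<Longrightarrow> g integrable_on {0..T-h}" for f g :: "real \<Rightarrow> 'c::banach"
    using has_integral_concat[OF h integrable_integral[OF f] integrable_integral[OF g]] by blast
  show "?w integrable_on {0..T}" using ui by (intro conc) auto
  have "(\<lambda>t. if t \<le> h then (norm (u t))\<^sup>2 else (norm (v (t-h)))\<^sup>2) integrable_on {0..T}"
    using ui by (intro conc) auto
  then show "(\<lambda>t. (norm (?w t))\<^sup>2) integrable_on {0..T}" by (simp add: if_distrib[of "\<lambda>u. (norm u)\<^sup>2"] cong: if_cong)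
  have "((\<lambda>t. if t \<le> h then A *v x t + B *v u t else A *v y (t - h) + B *v v (t - h)) has_integral
     (if T \<le> h then x (min T h) - x 0 else (x (min T h) - x 0) + (y (T - h) - y 0))) {0..T}"
    using ui by (intro has_integral_concat[OF h, where g="\<lambda>t. A *v y t + B *v v t"]) auto
  also have "(\<lambda>t. if t \<le> h then A *v x t + B *v u t else A *v y (t - h) + B *v v (t - h)) = (\<lambda>t. A *v ?z t + B *v ?w t)"
    by auto
  also have "(if T \<le> h then x (min T h) - x 0 else (x (min T h) - x 0) + (y (T - h) - y 0)) = ?z T - ?z 0"
    using h \<open>0 \<le> T\<close> \<open>x h = y 0\<close> by auto
  finally show "((\<lambda>t. A *v ?z t + B *v ?w t) has_integral ?z T - ?z 0) {0..T}" .
qed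

section \<open>The value function\<close>

text \<open>Cauchy's functional equation. The deviation \<open>d\<close> from the linear function is
  additive and vanishes on the integers, so it has period 1 and is bounded everywhere; since
  \<open>d (n * s) = n * d s\<close>, it must be zero.\<close>

lemma additive_bounded_imp_scaled:
  fixes f :: "real \<Rightarrow> real"
  assumes add: "\<And>s t. f (s + t) = f s + f t" and bound: "\<And>s. 0 \<le> s \<Longrightarrow> s \<le> 1 \<Longrightarrow> \<bar>f s\<bar> \<le> M"
  shows "f s = s * f 1"
proof -
  define d where "d s = f s - s * f 1" for s
  have dadd: "d (s + t) = d s + d t" for s t by (simp add: d_def add algebra_simps)
  have d0: "d 0 = 0" using dadd[of 0 0] by simp
  have d1: "d 1 = 0" by (simp add: d_def)
  have dneg: "d (- s) = - d s" for s using dadd[of s "- s"] d0 by simp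
  have dnat: "d (real n * s) = real n * d s" for n s
    by (induction n) (auto simp: d0 dadd algebra_simps)
  have dint: "d (real_of_int k) = 0" for k
    using dnat[of _ 1] d1 dneg by (cases k rule: int_cases2) auto
  have dbound: "\<bar>d s\<bar> \<le> M + \<bar>f 1\<bar>" for s
  proof -
    have "d s = d (frac s)" using dadd[of "real_of_int \<lfloor>s\<rfloor>" "frac s"] dint by (simp add: frac_def)
    also have "\<bar>\<dots>\<bar> \<le> \<bar>f (frac s)\<bar> + frac s * \<bar>f 1\<bar>"
      using abs_triangle_ineq4[of "f (frac s)" "frac s * f 1"] by (simp add: d_def abs_mult)
    also have "\<dots> \<le> M + 1 * \<bar>f 1\<bar>"
      using frac_lt_1[of s] by (intro add_mono bound mult_right_mono) auto
    finally show ?thesis by simp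
  qed
  have "d s = 0"
  proof (rule ccontr)
    assume "d s \<noteq> 0"
    then obtain n :: nat where n: "(M + \<bar>f 1\<bar>) / \<bar>d s\<bar> < real n" using reals_Archimedean2 by blast
    then have "M + \<bar>f 1\<bar> < real n * \<bar>d s\<bar>" using \<open>d s \<noteq> 0\<close> by (simp add: field_simps)
    then show False using dbound[of "real n * s"] dnat[of n s] by (simp add: abs_mult)
  qed
  then show ?thesis by (simp add: d_def)
qed

text \<open>The Jordan-von Neumann argument: the polarization \<open>b\<close> is additive by the
  parallelogram law and real-homogeneous by a local bound, hence bilinear.\<close>

lemma parallelogram_imp_quadratic_form:
  fixes V :: "real^'n \<Rightarrow> real"
  assumes hom: "\<And>a x. V (a *\<^sub>R x) = a\<^sup>2 * V x"
    and par: "\<And>x y. V (x + y) + V (x - y) = 2 * V x + 2 * V y"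
    and nonneg: "\<And>x. 0 \<le> V x" and bound: "\<And>x. V x \<le> C * (norm x)\<^sup>2"
  shows "\<exists>E. transpose E = E \<and> (\<forall>x. V x = (E *v x) \<bullet> x)"
proof -
  define b where "b x y = (V (x + y) - V (x - y)) / 4" for x y
  have V0: "V 0 = 0" using hom[of 0 0] by simp
  have Vneg: "V (- x) = V x" for x using hom[of "-1" x] by simp
  have sym: "b x y = b y x" for x y using Vneg[of "x - y"] by (simp add: b_def add.commute)
  have b0: "b 0 y = 0" for y by (simp add: b_def Vneg)
  \<comment> \<open>The law is used at \<open>(x + y, z + y)\<close> and at
    \<open>(x - y, z - y)\<close>; both instances contain \<open>V (x - z)\<close>, which cancels on
    subtraction.\<close>
  have half: "2 * (b x y + b z y) = b (x + z) (2 *\<^sub>R y)" for x y z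
  proof -
    have eqs: "x + y + (z + y) = x + z + 2 *\<^sub>R y" "x + y - (z + y) = x - z"
      "x - y + (z - y) = x + z - 2 *\<^sub>R y" "x - y - (z - y) = x - z"
      by (simp_all add: scaleR_2)
    have "2 * ((a - b) / 4 + (c - d) / 4) = (p - q) / 4"
      if "p + m = 2 * a + 2 * c" "q + m = 2 * b + 2 * d" for a b c d p q m :: real
      using that by (simp add: field_simps)
    from this[OF par[of "x + y" "z + y", unfolded eqs] par[of "x - y" "z - y", unfolded eqs]]
    show ?thesis by (simp only: b_def)
  qed
  have double: "b x (2 *\<^sub>R y) = 2 * b x y" for x y using half[of x y 0] by (simp add: b0)
  have add: "b (x + z) y = b x y + b z y" for x y z using half[of x y z] double[of "x + z" y] by simp
  have scale: "b (s *\<^sub>R x) y = s * b x y" for s x y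
  proof -
    have "b (s *\<^sub>R x) y = s * b (1 *\<^sub>R x) y"
    proof (rule additive_bounded_imp_scaled[where f = "\<lambda>s. b (s *\<^sub>R x) y"])
      show "b ((s + t) *\<^sub>R x) y = b (s *\<^sub>R x) y + b (t *\<^sub>R x) y" for s t
        by (simp add: scaleR_add_left add)
      fix t :: real assume t: "0 \<le> t" "t \<le> 1"
      \<comment> \<open>Nonnegativity bounds the difference in \<open>b\<close> by the corresponding
        sum, and the parallelogram law evaluates that sum. This is the local bound that excludes
        wild additive functions.\<close>
      have "\<bar>b (t *\<^sub>R x) y\<bar> \<le> (V (t *\<^sub>R x + y) + V (t *\<^sub>R x - y)) / 4"
        using nonneg[of "t *\<^sub>R x + y"] nonneg[of "t *\<^sub>R x - y"] by (simp add: b_def abs_le_iff)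
      also have "\<dots> = (t\<^sup>2 * V x + V y) / 2" using par[of "t *\<^sub>R x" y] by (simp add: hom)
      also have "\<dots> \<le> (1 * V x + V y) / 2"
        using t nonneg by (intro divide_right_mono add_right_mono mult_right_mono power_le_one) auto
      finally show "\<bar>b (t *\<^sub>R x) y\<bar> \<le> (V x + V y) / 2" by simp
    qed
    then show ?thesis by simp
  qed
  define f where "f x = (\<Sum>i\<in>Basis. b x i *\<^sub>R i)" for x
  have "linear f"
    by (intro linearI) (simp_all add: f_def add scale scaleR_add_left sum.distrib scaleR_sum_right)
  have fb: "f x \<bullet> y = b x y" for x y
  proof -
    have "linear (b x)" using add scale sym by (intro linearI) simp_all
    then have "b x y = (\<Sum>i\<in>Basis. (y \<bullet> i) * b x i)"
      using linear_sum[of "b x" "\<lambda>i. (y \<bullet> i) *\<^sub>R i" Basis]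
      by (simp add: euclidean_representation linear_scale)
    then show ?thesis by (simp add: f_def inner_sum_left inner_commute[of y] mult.commute)
  qed
  define E where "E = matrix f"
  have E: "(E *v x) \<bullet> y = b x y" for x y
    using fb \<open>linear f\<close> by (simp add: E_def matrix_works)
  have "transpose E *v y = E *v y" for y
  proof -
    have "x \<bullet> (transpose E *v y) = x \<bullet> (E *v y)" for x
      using E[of x y] E[of y x] sym[of x y] matrix_vector_inner_transpose[of E x y]
      by (simp add: inner_commute)
    then show ?thesis by (metis vector_eq_ldot)
  qed
  then have "transpose E = E" by (simp add: matrix_eq)
  moreover have "V x = (E *v x) \<bullet> x" for x
    using hom[of 2 x] V0 by (simp add: E b_def scaleR_2)
  ultimately show ?thesis by blast
qed

section \<open>Truncated costs and dynamic programming\<close>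

locale lq_regulator =
  fixes A :: "real^'n^'n" and B :: "real^'m^'n" and Q :: "real^'n^'n" and R :: "real^'m^'m"
  assumes Q: "sym_pos_def Q" and R: "sym_pos_def R"
begin

definition running_cost :: "real^'n \<Rightarrow> real^'m \<Rightarrow> real" where
  "running_cost x u = (Q *v x) \<bullet> x + (R *v u) \<bullet> u"

lemma Q_nonneg: "0 \<le> (Q *v x) \<bullet> x"
  using Q by (cases "x = 0") (auto simp: sym_pos_def_def intro: less_imp_le)

lemma R_nonneg: "0 \<le> (R *v u) \<bullet> u"
  using R by (cases "u = 0") (auto simp: sym_pos_def_def intro: less_imp_le)

lemma running_cost_nonneg: "0 \<le> running_cost x u"
  using Q_nonneg R_nonneg by (simp add: running_cost_def)

lemma running_cost_coercive: "\<exists>l>0. \<forall>x u. l * ((norm x)\<^sup>2 + (norm u)\<^sup>2) \<le> running_cost x u"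
proof -
  obtain k l where "k > 0" and k: "\<And>x. k * (norm x)\<^sup>2 \<le> (Q *v x) \<bullet> x"
    and "l > 0" and l: "\<And>u. l * (norm u)\<^sup>2 \<le> (R *v u) \<bullet> u"
    using sym_pos_def_coercive[OF Q] sym_pos_def_coercive[OF R] by metis
  have "min k l * ((norm x)\<^sup>2 + (norm u)\<^sup>2) \<le> running_cost x u" for x u
  proof -
    have "min k l * ((norm x)\<^sup>2 + (norm u)\<^sup>2) \<le> k * (norm x)\<^sup>2 + l * (norm u)\<^sup>2"
      unfolding distrib_left by (intro add_mono mult_right_mono) auto
    then show ?thesis using k[of x] l[of u] by (simp add: running_cost_def)
  qed
  then show ?thesis using \<open>k > 0\<close> \<open>l > 0\<close> by (intro exI[of _ "min k l"]) auto
qed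

definition cost :: "(real \<Rightarrow> real^'n) \<Rightarrow> (real \<Rightarrow> real^'m) \<Rightarrow> real \<Rightarrow> real" where
  "cost x u T = integral {0..T} (\<lambda>t. running_cost (x t) (u t))"

lemma running_cost_integrable:
  assumes "control_traj A B x u"
  shows "(\<lambda>t. running_cost (x t) (u t)) integrable_on {0..T}"
proof (cases "T \<ge> 0")
  case True
  obtain K where "K > 0" and K: "\<And>x y. \<bar>(R *v x) \<bullet> y\<bar> \<le> K * (norm x * norm y)"
    using matrix_vector_inner_bound[of R] by blast
  have "(\<lambda>t. (R *v u t) \<bullet> u t) integrable_on {0..T}"
  proof (rule measurable_bounded_by_integrable_imp_integrable)
    show "(\<lambda>t. (R *v u t) \<bullet> u t) \<in> borel_measurable (lebesgue_on {0..T})"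
      by (intro borel_measurable_inner borel_measurable_matrix_vector control_traj_measurable[OF assms])
    show "(\<lambda>t. K * (norm (u t))\<^sup>2) integrable_on {0..T}"
      using assms True by (intro integrable_on_mult_right) (simp add: control_traj_def)
    show "norm ((R *v u t) \<bullet> u t) \<le> K * (norm (u t))\<^sup>2" for t
      using K[of "u t" "u t"] by (simp add: power2_eq_square)
  qed auto
  moreover have "(\<lambda>t. (Q *v x t) \<bullet> x t) integrable_on {0..T}"
    by (intro integrable_continuous_real continuous_on_inner control_traj_continuous[OF assms]
        bounded_linear.continuous_on[OF matrix_vector_mul_bounded_linear control_traj_continuous[OF assms]])
  ultimately show ?thesis unfolding running_cost_def by (intro integrable_add)
qed auto

lemma cost_nonneg: "control_traj A B x u \<Longrightarrow> 0 \<le> cost x u T"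
  unfolding cost_def by (intro Henstock_Kurzweil_Integration.integral_nonneg running_cost_integrable running_cost_nonneg)

lemma cost_shift:
  assumes "control_traj A B x u" "0 \<le> s" "0 \<le> T"
  shows "cost x u (T + s) = cost x u s + cost (\<lambda>t. x (t + s)) (\<lambda>t. u (t + s)) T"
proof -
  have "cost (\<lambda>t. x (t + s)) (\<lambda>t. u (t + s)) T = integral {s..T + s} (\<lambda>t. running_cost (x t) (u t))"
    using integral_shift_real_ivl[where a = s and b = "T + s" and c = s and f = "\<lambda>t. running_cost (x t) (u t)"] by (simp add: cost_def)
  then show ?thesis
    using Henstock_Kurzweil_Integration.integral_combine[OF \<open>0 \<le> s\<close> _ running_cost_integrable[OF assms(1)], of "T + s"] \<open>0 \<le> T\<close>
    by (simp add: cost_def)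
qed

lemma cost_mono:
  assumes "control_traj A B x u" "0 \<le> S" "S \<le> T"
  shows "cost x u S \<le> cost x u T"
  using cost_shift[OF assms(1,2), of "T - S"] cost_nonneg[OF control_traj_shift[OF assms(1,2)], of "T - S"] assms by simp

text \<open>Bounding all truncations by \<open>c\<close> expresses a total cost of at most
  \<open>c\<close> without an improper integral; \<open>cost\<close> is monotone in the
  horizon.\<close>

definition admissible :: "real^'n \<Rightarrow> real \<Rightarrow> bool" where
  "admissible x0 c \<longleftrightarrow> (\<exists>x u. control_traj A B x u \<and> x 0 = x0 \<and> (\<forall>T\<ge>0. cost x u T \<le> c))"

definition value_fun :: "real^'n \<Rightarrow> real" where
  "value_fun x0 = Inf {c. admissible x0 c}"

lemma admissible_nonneg: "admissible x0 c \<Longrightarrow> 0 \<le> c"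
  unfolding admissible_def using cost_nonneg by (meson order.refl order_trans)

lemma value_fun_le: "admissible x0 c \<Longrightarrow> value_fun x0 \<le> c"
  unfolding value_fun_def using admissible_nonneg by (intro cInf_lower bdd_belowI) auto

text \<open>One half of the dynamic programming principle: what a trajectory has not yet spent at
  time \<open>s\<close> bounds the value of \<open>x s\<close>. The other half is
  \<open>admissible_concat\<close>, which prepends an arbitrary initial segment.\<close>

lemma admissible_tail:
  assumes "control_traj A B x u" "\<And>T. T \<ge> 0 \<Longrightarrow> cost x u T \<le> c" "0 \<le> s"
  shows "admissible (x s) (c - cost x u s)"
  unfolding admissible_def
proof (intro exI conjI allI impI)
  show "control_traj A B (\<lambda>t. x (t + s)) (\<lambda>t. u (t + s))" by (rule control_traj_shift[OF assms(1,3)])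
  fix T :: real assume "0 \<le> T"
  show "cost (\<lambda>t. x (t + s)) (\<lambda>t. u (t + s)) T \<le> c - cost x u s"
    using cost_shift[OF assms(1,3) \<open>0 \<le> T\<close>] assms(2)[of "T + s"] assms(3) \<open>0 \<le> T\<close> by simp
qed simp

lemma admissible_concat:
  assumes x: "control_traj A B x u" and "0 \<le> h" and c: "admissible (x h) c"
  shows "admissible (x 0) (cost x u h + c)"
proof -
  obtain y v where y: "control_traj A B y v" "y 0 = x h" and yc: "\<And>T. T \<ge> 0 \<Longrightarrow> cost y v T \<le> c"
    using c by (auto simp: admissible_def)
  let ?z = "\<lambda>t. if t \<le> h then x t else y (t - h)" and ?w = "\<lambda>t. if t \<le> h then u t else v (t - h)"
  have "cost ?z ?w T \<le> cost x u h + c" if "T \<ge> 0" for T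
  proof -
    have "((\<lambda>t. if t \<le> h then running_cost (x t) (u t) else running_cost (y (t - h)) (v (t - h))) has_integral
      (if T \<le> h then cost x u (min T h) else cost x u (min T h) + cost y v (T - h))) {0..T}"
      unfolding cost_def
      by (intro has_integral_concat[OF \<open>0 \<le> h\<close>, where g = "\<lambda>t. running_cost (y t) (v t)"] integrable_integral running_cost_integrable x y)
    also have "(\<lambda>t. if t \<le> h then running_cost (x t) (u t) else running_cost (y (t - h)) (v (t - h))) = (\<lambda>t. running_cost (?z t) (?w t))"
      by auto
    finally have "cost ?z ?w T = (if T \<le> h then cost x u (min T h) else cost x u (min T h) + cost y v (T - h))"
      unfolding cost_def by (rule integral_unique)
    then show ?thesis
      using cost_mono[OF x, of T h] yc[of "T - h"] admissible_nonneg[OF c] \<open>T \<ge> 0\<close> \<open>0 \<le> h\<close> by auto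
  qed
  moreover have "control_traj A B ?z ?w" using control_traj_concat[OF \<open>0 \<le> h\<close> x y(1)] y(2) by simp
  ultimately show ?thesis unfolding admissible_def using \<open>0 \<le> h\<close>
    by (intro exI[of _ ?z] exI[of _ ?w]) auto
qed

lemma running_cost_scale: "running_cost (a *\<^sub>R x) (a *\<^sub>R u) = a\<^sup>2 * running_cost x u"
  by (simp add: running_cost_def matrix_vector_mult_scaleR power2_eq_square algebra_simps)

lemma running_cost_parallelogram:
  "running_cost (x + y) (u + v) + running_cost (x - y) (u - v) = 2 * running_cost x u + 2 * running_cost y v"
  by (simp add: running_cost_def matrix_vector_right_distrib matrix_vector_mult_diff_distrib
      inner_add_left inner_add_right inner_diff_left inner_diff_right)

lemma admissible_scale:
  assumes "admissible x0 c"
  shows "admissible (a *\<^sub>R x0) (a\<^sup>2 * c)"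
proof -
  obtain x u where x: "control_traj A B x u" "x 0 = x0" and c: "\<And>T. T \<ge> 0 \<Longrightarrow> cost x u T \<le> c"
    using assms by (auto simp: admissible_def)
  have "control_traj A B (\<lambda>t. a *\<^sub>R x t) (\<lambda>t. a *\<^sub>R u t)"
    using control_traj_lincomb[OF x(1) x(1), of a 0] by simp
  moreover have "cost (\<lambda>t. a *\<^sub>R x t) (\<lambda>t. a *\<^sub>R u t) T = a\<^sup>2 * cost x u T" for T
    by (simp add: cost_def running_cost_scale)
  moreover have "a\<^sup>2 * cost x u T \<le> a\<^sup>2 * c" if "T \<ge> 0" for T using c[OF that] by (intro mult_left_mono) auto
  ultimately show ?thesis unfolding admissible_def using x(2)
    by (intro exI[of _ "\<lambda>t. a *\<^sub>R x t"] exI[of _ "\<lambda>t. a *\<^sub>R u t"]) auto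
qed

text \<open>Linearity makes sum and difference of two trajectories into trajectories, and on each
  horizon the four costs satisfy the parallelogram identity of the running cost.\<close>

lemma admissible_parallelogram:
  assumes "admissible x0 c" "admissible y0 d"
  shows "value_fun (x0 + y0) + value_fun (x0 - y0) \<le> 2 * c + 2 * d"
proof -
  obtain x u where x: "control_traj A B x u" "x 0 = x0" and c: "\<And>T. T \<ge> 0 \<Longrightarrow> cost x u T \<le> c"
    using assms(1) by (auto simp: admissible_def)
  obtain y v where y: "control_traj A B y v" "y 0 = y0" and d: "\<And>T. T \<ge> 0 \<Longrightarrow> cost y v T \<le> d"
    using assms(2) by (auto simp: admissible_def)
  define p pu m mu where "p = (\<lambda>t. x t + y t)" "pu = (\<lambda>t. u t + v t)" "m = (\<lambda>t. x t - y t)" "mu = (\<lambda>t. u t - v t)"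
  note defs = this
  have p: "control_traj A B p pu" and m: "control_traj A B m mu"
    using control_traj_lincomb[OF x(1) y(1), of 1 1] control_traj_lincomb[OF x(1) y(1), of 1 "-1"]
    by (simp_all add: defs)
  have sum: "cost p pu T + cost m mu T = 2 * cost x u T + 2 * cost y v T" for T
  proof -
    have "cost p pu T + cost m mu T = integral {0..T} (\<lambda>t. running_cost (p t) (pu t) + running_cost (m t) (mu t))"
      unfolding cost_def by (intro Henstock_Kurzweil_Integration.integral_add[symmetric] running_cost_integrable p m)
    also have "\<dots> = integral {0..T} (\<lambda>t. 2 * running_cost (x t) (u t) + 2 * running_cost (y t) (v t))"
      by (simp add: defs running_cost_parallelogram)
    also have "\<dots> = 2 * cost x u T + 2 * cost y v T"
      unfolding cost_def
      by (subst Henstock_Kurzweil_Integration.integral_add)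
        (auto intro!: integrable_on_mult_right running_cost_integrable x y)
    finally show ?thesis .
  qed
  \<comment> \<open>The identity couples equal horizons. Monotonicity lets them vary independently,
    so that one horizon can be frozen while the other exhausts the half-line.\<close>
  have le: "cost p pu T + cost m mu S \<le> 2 * c + 2 * d" if "T \<ge> 0" "S \<ge> 0" for T S
    using cost_mono[OF p, of T "max T S"] cost_mono[OF m, of S "max T S"] sum[of "max T S"] c[of "max T S"] d[of "max T S"] that
    by (simp add: le_max_iff_disj)
  \<comment> \<open>For frozen \<open>S\<close> the unspent budget is an admissible bound for the
    sum trajectory, hence at least \<open>value_fun (x0 + y0)\<close>; read the other way, this
    bounds the cost of the difference trajectory.\<close>
  have "cost m mu S \<le> 2 * c + 2 * d - value_fun (x0 + y0)" if "S \<ge> 0" for S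
  proof -
    have "admissible (x0 + y0) (2 * c + 2 * d - cost m mu S)"
      unfolding admissible_def using le[OF _ that] p x(2) y(2)
      by (intro exI[of _ p] exI[of _ pu]) (auto simp: defs algebra_simps)
    from value_fun_le[OF this] show ?thesis by simp
  qed
  then have "admissible (x0 - y0) (2 * c + 2 * d - value_fun (x0 + y0))"
    unfolding admissible_def using m x(2) y(2)
    by (intro exI[of _ m] exI[of _ mu]) (auto simp: defs)
  from value_fun_le[OF this] show ?thesis by simp
qed

end

section \<open>The value function as a quadratic form\<close>

locale stabilizable_lq_regulator = lq_regulator A B Q R
  for A :: "real^'n^'n" and B :: "real^'m^'n" and Q :: "real^'n^'n" and R :: "real^'m^'m" +
  assumes stabilizable: "\<exists>c. admissible x0 c"
begin

lemma value_fun_greatest: "(\<And>c. admissible x0 c \<Longrightarrow> b \<le> c) \<Longrightarrow> b \<le> value_fun x0"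
  unfolding value_fun_def using stabilizable by (intro cInf_greatest) auto

lemma value_fun_nonneg: "0 \<le> value_fun x0"
  using admissible_nonneg by (rule value_fun_greatest)

lemma value_fun_scale_le: "value_fun (a *\<^sub>R x) \<le> a\<^sup>2 * value_fun x"
proof (cases "a = 0")
  case True
  obtain c where "admissible x c" using stabilizable by blast
  from value_fun_le[OF admissible_scale[OF this, of a]] True show ?thesis by simp
next
  case False
  have "value_fun (a *\<^sub>R x) / a\<^sup>2 \<le> value_fun x"
    using value_fun_le[OF admissible_scale, of x _ a] False
    by (intro value_fun_greatest) (simp add: field_simps)
  then show ?thesis using False by (simp add: field_simps)
qed

lemma value_fun_scale: "value_fun (a *\<^sub>R x) = a\<^sup>2 * value_fun x"
proof (cases "a = 0")
  case True
  then show ?thesis using value_fun_scale_le[of a x] value_fun_nonneg[of 0] by simp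
next
  case False
  have "value_fun x \<le> value_fun (a *\<^sub>R x) / a\<^sup>2"
    using value_fun_scale_le[of "inverse a" "a *\<^sub>R x"] False by (simp add: field_simps)
  then show ?thesis using value_fun_scale_le[of a x] False by (simp add: field_simps)
qed

lemma value_fun_parallelogram_le:
  "value_fun (x + y) + value_fun (x - y) \<le> 2 * value_fun x + 2 * value_fun y"
proof -
  \<comment> \<open>The two infima are taken one after the other, with the bound \<open>d\<close>
    for \<open>y\<close> fixed during the first.\<close>
  have "(value_fun (x + y) + value_fun (x - y) - 2 * d) / 2 \<le> value_fun x" if "admissible y d" for d
    by (rule value_fun_greatest) (use admissible_parallelogram[OF _ that, of x] in \<open>fastforce simp: field_simps\<close>)
  then have "(value_fun (x + y) + value_fun (x - y) - 2 * value_fun x) / 2 \<le> value_fun y"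
    by (intro value_fun_greatest) (fastforce simp: field_simps)
  then show ?thesis by simp
qed

text \<open>The inequality is its own converse: at \<open>x + y\<close> and \<open>x - y\<close> it
  bounds the values of \<open>2 *\<^sub>R x\<close> and \<open>2 *\<^sub>R y\<close>, which
  homogeneity turns into factors 4.\<close>

lemma value_fun_parallelogram:
  "value_fun (x + y) + value_fun (x - y) = 2 * value_fun x + 2 * value_fun y"
  using value_fun_parallelogram_le[of x y] value_fun_parallelogram_le[of "x + y" "x - y"]
    value_fun_scale[of 2 x] value_fun_scale[of 2 y] by (simp add: scaleR_2)

text \<open>Induction over the basis: by the parallelogram law and nonnegativity, the value of a sum
  is at most twice the sum of the values.\<close>

lemma value_fun_bounded: "\<exists>C. \<forall>x. value_fun x \<le> C * (norm x)\<^sup>2"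
proof -
  have "\<exists>C\<ge>0. \<forall>x. value_fun (\<Sum>i\<in>S. (x \<bullet> i) *\<^sub>R i) \<le> C * (norm x)\<^sup>2"
    if "finite S" "S \<subseteq> Basis" for S :: "(real^'n) set"
    using that
  proof (induction S)
    case empty
    show ?case using value_fun_scale[of 0 0] by (intro exI[of _ 0]) simp
  next
    case (insert i S)
    then obtain C where "C \<ge> 0" and C: "\<And>x. value_fun (\<Sum>i\<in>S. (x \<bullet> i) *\<^sub>R i) \<le> C * (norm x)\<^sup>2" by blast
    have "value_fun (\<Sum>i\<in>insert i S. (x \<bullet> i) *\<^sub>R i) \<le> (2 * value_fun i + 2 * C) * (norm x)\<^sup>2" for x
    proof -
      let ?r = "\<Sum>i\<in>S. (x \<bullet> i) *\<^sub>R i"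
      have "\<bar>x \<bullet> i\<bar> \<le> norm x" using insert by (intro Basis_le_norm) auto
      then have "(x \<bullet> i)\<^sup>2 \<le> (norm x)\<^sup>2" by (simp add: abs_le_square_iff[symmetric])
      then have 1: "(x \<bullet> i)\<^sup>2 * value_fun i \<le> (norm x)\<^sup>2 * value_fun i"
        using value_fun_nonneg by (intro mult_right_mono)
      have "value_fun ((x \<bullet> i) *\<^sub>R i + ?r) \<le> 2 * value_fun ((x \<bullet> i) *\<^sub>R i) + 2 * value_fun ?r"
        using value_fun_parallelogram[of "(x \<bullet> i) *\<^sub>R i" ?r] value_fun_nonneg[of "(x \<bullet> i) *\<^sub>R i - ?r"] by linarith
      then show ?thesis using 1 C[of x] insert by (simp add: value_fun_scale algebra_simps)
    qed
    moreover have "2 * value_fun i + 2 * C \<ge> 0" using \<open>C \<ge> 0\<close> value_fun_nonneg[of i] by simp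
    ultimately show ?case by blast
  qed
  from this[of Basis] show ?thesis by (auto simp: euclidean_representation)
qed

lemma value_fun_quadratic: "\<exists>E. transpose E = E \<and> (\<forall>x. value_fun x = (E *v x) \<bullet> x)"
proof -
  obtain C where "\<And>x. value_fun x \<le> C * (norm x)\<^sup>2" using value_fun_bounded by blast
  then show ?thesis
    using value_fun_scale value_fun_parallelogram value_fun_nonneg
    by (intro parallelogram_imp_quadratic_form[of value_fun C]) auto
qed

end

section \<open>The Riccati equation\<close>

lemma symmetric_matrixI:
  fixes M :: "real^'n^'n"
  assumes "\<And>x y. (M *v x) \<bullet> y = (M *v y) \<bullet> x"
  shows "transpose M = M"
proof -
  have "x \<bullet> (transpose M *v y) = x \<bullet> (M *v y)" for x y
    using assms[of x y] matrix_vector_inner_transpose[of M x y] by (simp add: inner_commute)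
  then have "transpose M *v y = M *v y" for y by (metis vector_eq_ldot)
  then show ?thesis by (simp add: matrix_eq)
qed

lemma matrix_inv_right_sym_pos_def:
  fixes R :: "real^'m^'m"
  assumes "sym_pos_def R"
  shows "R ** matrix_inv R = mat 1"
proof -
  have "x = 0" if "R *v x = 0" for x
    using assms that unfolding sym_pos_def_def by (metis inner_zero_left less_irrefl)
  then have "invertible R"
    using matrix_left_invertible_ker[of R] invertible_left_inverse[of R] by blast
  then show ?thesis
    unfolding invertible_def matrix_inv_def by (rule someI2_ex) blast
qed

text \<open>The inhomogeneity becomes linear after adding a coordinate that stays equal to
  1.\<close>

lemma affine_ode_exists:
  fixes M :: "real^'n^'n"
  shows "\<exists>x. x 0 = z \<and> (\<forall>t. (x has_vector_derivative (M *v x t + b)) (at t))"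
proof -
  let ?f = "\<lambda>p. (M *v fst p + snd p *\<^sub>R b, 0::real)"
  have "linear ?f"
    by (intro linearI) (auto simp: matrix_vector_right_distrib matrix_vector_mult_scaleR algebra_simps)
  then obtain y where y0: "y 0 = (z, 1)" and y: "\<And>t. (y has_vector_derivative ?f (y t)) (at t)"
    using linear_ode_exists[of ?f "(z, 1)"] by auto
  have fst: "((\<lambda>t. fst (y t)) has_vector_derivative fst (?f (y t))) (at t)" for t
    using bounded_linear.has_vector_derivative[OF bounded_linear_fst y] .
  have "((\<lambda>t. snd (y t)) has_vector_derivative snd (?f (y t))) (at t)" for t
    using bounded_linear.has_vector_derivative[OF bounded_linear_snd y] .
  then have "\<forall>t. DERIV (\<lambda>t. snd (y t)) t :> 0"
    by (simp add: has_real_derivative_iff_has_vector_derivative)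
  then have "snd (y t) = 1" for t using DERIV_isconst_all[of "\<lambda>t. snd (y t)" t 0] y0 by simp
  then show ?thesis using fst y0 by (intro exI[of _ "\<lambda>t. fst (y t)"]) auto
qed

lemma control_trajI:
  assumes x: "\<And>t. (x has_vector_derivative (A *v x t + B *v u t)) (at t)" and u: "continuous_on UNIV u"
  shows "control_traj A B x u"
  unfolding control_traj_def
proof (intro allI impI conjI)
  fix T :: real assume "0 \<le> T"
  have u': "continuous_on {0..T} u" using u continuous_on_subset by blast
  then show "u integrable_on {0..T}" by (rule integrable_continuous_real)
  show "(\<lambda>t. (norm (u t))\<^sup>2) integrable_on {0..T}"
    using u' by (intro integrable_continuous_real continuous_intros)
  show "((\<lambda>t. A *v x t + B *v u t) has_integral x T - x 0) {0..T}"
    using \<open>0 \<le> T\<close> has_vector_derivative_at_within[OF x] by (rule fundamental_theorem_of_calculus)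
qed

lemma nonneg_of_integral_nonneg:
  fixes g :: "real \<Rightarrow> real"
  assumes g: "continuous_on UNIV g" and int: "\<And>h. h \<ge> 0 \<Longrightarrow> 0 \<le> integral {0..h} g"
  shows "0 \<le> g 0"
proof (rule ccontr)
  assume "\<not> 0 \<le> g 0"
  have "isCont g 0" using g by (simp add: continuous_on_eq_continuous_at)
  then obtain d where "d > 0" and d: "\<And>t. dist t 0 < d \<Longrightarrow> dist (g t) (g 0) < - g 0 / 2"
    using \<open>\<not> 0 \<le> g 0\<close> unfolding continuous_at_eps_delta
    by (metis half_gt_zero neg_0_less_iff_less not_le)
  have "g t \<le> g 0 / 2" if "t \<in> {0..d/2}" for t
    using d[of t] that \<open>d > 0\<close> by (auto simp: dist_real_def)
  then have "integral {0..d/2} g \<le> integral {0..d/2} (\<lambda>t. g 0 / 2)"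
    using continuous_on_subset[OF g]
    by (intro integral_le integrable_continuous_real) auto
  also have "\<dots> = d / 2 * (g 0 / 2)" using \<open>d > 0\<close> by simp
  also have "\<dots> < 0" using \<open>d > 0\<close> \<open>\<not> 0 \<le> g 0\<close> by (simp add: mult_less_0_iff)
  finally show False using int[of "d/2"] \<open>d > 0\<close> by simp
qed

section \<open>Completing the square\<close>

context lq_regulator
begin

text \<open>Sign convention: the optimal feedback is \<open>- (gain E *v x)\<close>, so
  \<open>u + gain E *v x\<close> measures the deviation from it.\<close>

definition gain :: "real^'n^'n \<Rightarrow> real^'n^'m" where
  "gain E = matrix_inv R ** transpose B ** E"

text \<open>The negative of the left-hand side in \<open>riccati_solution\<close>, so that it enters
  the energy identity with a plus sign.\<close>

definition riccati_defect :: "real^'n^'n \<Rightarrow> real^'n^'n" where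
  "riccati_defect E = Q + transpose A ** E + E ** A - E ** B ** gain E"

lemma riccati_solution_iff: "riccati_solution A B Q R E \<longleftrightarrow> riccati_defect E = 0"
proof -
  have "E ** B ** matrix_inv R ** transpose B ** E = E ** B ** gain E"
    by (simp add: gain_def matrix_mul_assoc)
  then show ?thesis unfolding riccati_solution_def riccati_defect_def by (auto simp: algebra_simps)
qed

lemma R_gain: "R *v (gain E *v x) = transpose B *v (E *v x)"
proof -
  have "R *v (gain E *v x) = (R ** matrix_inv R) *v (transpose B *v (E *v x))"
    by (simp add: gain_def matrix_vector_mul_assoc matrix_mul_assoc)
  then show ?thesis by (simp add: matrix_inv_right_sym_pos_def[OF R])
qed

context
  fixes E :: "real^'n^'n"
  assumes E: "transpose E = E"
begin

lemma gain_form: "(E *v (B *v u)) \<bullet> x = (R *v (gain E *v x)) \<bullet> u"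
proof -
  have "(E *v (B *v u)) \<bullet> x = (B *v u) \<bullet> (E *v x)"
    using symmetric_matrix_inner[OF E, of "B *v u" x] by (simp add: inner_commute)
  also have "\<dots> = u \<bullet> (transpose B *v (E *v x))" by (rule matrix_vector_inner_transpose)
  finally show ?thesis by (simp add: R_gain inner_commute)
qed

lemma riccati_defect_form:
  "(riccati_defect E *v x) \<bullet> y = (Q *v x) \<bullet> y + (E *v x) \<bullet> (A *v y) + (E *v (A *v x)) \<bullet> y
     - (R *v (gain E *v y)) \<bullet> (gain E *v x)"
proof -
  have "(riccati_defect E *v x) \<bullet> y = (Q *v x) \<bullet> y + (transpose A *v (E *v x)) \<bullet> y + (E *v (A *v x)) \<bullet> y
     - (E *v (B *v (gain E *v x))) \<bullet> y"
    by (simp add: riccati_defect_def matrix_vector_mult_diff_rdistrib matrix_vector_mult_add_rdistrib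
        inner_diff_left inner_add_left matrix_vector_mul_assoc matrix_mul_assoc)
  moreover have "(transpose A *v (E *v x)) \<bullet> y = (E *v x) \<bullet> (A *v y)"
    using matrix_vector_inner_transpose[of A y "E *v x"] by (simp add: inner_commute)
  ultimately show ?thesis by (simp add: gain_form)
qed

lemma riccati_defect_symmetric: "transpose (riccati_defect E) = riccati_defect E"
proof (rule symmetric_matrixI)
  fix x y
  have "(Q *v x) \<bullet> y = (Q *v y) \<bullet> x" "(R *v (gain E *v y)) \<bullet> (gain E *v x) = (R *v (gain E *v x)) \<bullet> (gain E *v y)"
    using Q R symmetric_matrix_inner by (auto simp: sym_pos_def_def)
  moreover have "(E *v (A *v x)) \<bullet> y = (E *v y) \<bullet> (A *v x)" "(E *v x) \<bullet> (A *v y) = (E *v (A *v y)) \<bullet> x"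
    using symmetric_matrix_inner[OF E] by metis+
  ultimately show "(riccati_defect E *v x) \<bullet> y = (riccati_defect E *v y) \<bullet> x"
    by (simp add: riccati_defect_form)
qed

text \<open>Since \<open>R ** gain E\<close> acts as \<open>transpose B ** E\<close>, the cross term
  between \<open>x\<close> and \<open>u\<close> is the one in the expanded square; the remaining
  term, quadratic in \<open>gain E *v x\<close>, is what the defect subtracts.\<close>

lemma complete_the_square:
  "running_cost x u + 2 * ((E *v x) \<bullet> (A *v x + B *v u)) =
   (riccati_defect E *v x) \<bullet> x + (R *v (u + gain E *v x)) \<bullet> (u + gain E *v x)"
proof -
  have "(R *v u) \<bullet> (gain E *v x) = (R *v (gain E *v x)) \<bullet> u"
    using R symmetric_matrix_inner by (auto simp: sym_pos_def_def)
  moreover have "(E *v x) \<bullet> (B *v u) = (R *v (gain E *v x)) \<bullet> u"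
    using gain_form[of u x] symmetric_matrix_inner[OF E, of "B *v u" x] by simp
  moreover have "(E *v (A *v x)) \<bullet> x = (E *v x) \<bullet> (A *v x)" by (rule symmetric_matrix_inner[OF E])
  ultimately show ?thesis
    by (simp add: running_cost_def riccati_defect_form matrix_vector_right_distrib inner_add_left inner_add_right)
qed

lemma energy_balance:
  assumes "control_traj A B x u" "0 \<le> T"
  shows "((\<lambda>t. (riccati_defect E *v x t) \<bullet> x t + (R *v (u t + gain E *v x t)) \<bullet> (u t + gain E *v x t)) has_integral
     (cost x u T + ((E *v x T) \<bullet> x T - (E *v x 0) \<bullet> x 0))) {0..T}"
  unfolding complete_the_square[symmetric] cost_def
  by (rule has_integral_add[OF integrable_integral[OF running_cost_integrable[OF assms(1)]]
        control_traj_quadratic[OF assms(1,2) E]])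

end

end

section \<open>The value function solves the Riccati equation\<close>

context stabilizable_lq_regulator
begin

context
  fixes E :: "real^'n^'n"
  assumes E: "transpose E = E" and value_E: "\<And>x. value_fun x = (E *v x) \<bullet> x"
begin

text \<open>Holding a constant control for a short time and then playing almost optimally cannot beat
  the value function.\<close>
lemma riccati_defect_nonneg: "0 \<le> (riccati_defect E *v x0) \<bullet> x0"
proof -
  \<comment> \<open>The constant for which the square vanishes at time 0, so that the integrand
    \<open>g\<close> of the energy identity starts at the defect form of \<open>x0\<close>.\<close>
  let ?u = "- (gain E *v x0)"
  obtain x where x0: "x 0 = x0" and x: "\<And>t. (x has_vector_derivative (A *v x t + B *v ?u)) (at t)"
    using affine_ode_exists[of x0 A "B *v ?u"] by blast
  have traj: "control_traj A B x (\<lambda>t. ?u)" using x by (intro control_trajI) auto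
  have contx: "continuous_on UNIV x"
    using x by (intro continuous_at_imp_continuous_on) (blast intro: has_vector_derivative_continuous)
  define g where "g t = (riccati_defect E *v x t) \<bullet> x t + (R *v (?u + gain E *v x t)) \<bullet> (?u + gain E *v x t)" for t
  have "0 \<le> g 0"
  proof (rule nonneg_of_integral_nonneg)
    show "continuous_on UNIV g"
      unfolding g_def
      by (intro continuous_intros contx bounded_linear.continuous_on[OF matrix_vector_mul_bounded_linear])
    fix h :: real assume "h \<ge> 0"
    have "value_fun x0 - cost x (\<lambda>t. ?u) h \<le> value_fun (x h)"
      using value_fun_le[OF admissible_concat[OF traj \<open>h \<ge> 0\<close>]] x0
      by (intro value_fun_greatest) (fastforce simp: algebra_simps)
    then show "0 \<le> integral {0..h} g"
      using integral_unique[OF energy_balance[OF E traj \<open>h \<ge> 0\<close>]] x0 by (simp add: g_def[abs_def] value_E)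
  qed
  then show ?thesis by (simp add: g_def x0)
qed

text \<open>A cost bound controls the control only in the square mean. A weighted Young inequality
  bounds the speed by a small multiple of the running cost plus a constant; the first part
  integrates to little because the cost is at most \<open>C\<close>, the second because the time is
  short.\<close>

lemma control_traj_near:
  assumes "0 \<le> C" "0 < r"
  shows "\<exists>h>0. \<forall>x u. control_traj A B x u \<longrightarrow> (\<forall>T\<ge>0. cost x u T \<le> C) \<longrightarrow> (\<forall>t\<in>{0..h}. norm (x t - x 0) \<le> r)"
proof -
  obtain l where "l > 0" and l: "\<And>x u. l * ((norm x)\<^sup>2 + (norm u)\<^sup>2) \<le> running_cost x u"
    using running_cost_coercive by blast
  obtain a where "a > 0" and a: "\<And>x. norm (A *v x) \<le> a * norm x" using matrix_vector_norm_bound by blast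
  obtain b where "b > 0" and b: "\<And>u. norm (B *v u) \<le> b * norm u" using matrix_vector_norm_bound by blast
  define M where "M = a + b"
  have "M > 0" using \<open>a > 0\<close> \<open>b > 0\<close> by (simp add: M_def)
  \<comment> \<open>Adding 1 keeps \<open>D\<close> positive when \<open>C = 0\<close>. The choices
    of \<open>e\<close> and \<open>h\<close> below make each of the two parts of the displacement
    bound equal to \<open>r / 2\<close>.\<close>
  define D where "D = C + 1"
  have "D > 0" using \<open>0 \<le> C\<close> by (simp add: D_def)
  define e where "e = l * r / (2 * M * D)"
  have "e > 0" using \<open>0 < r\<close> \<open>l > 0\<close> \<open>M > 0\<close> \<open>D > 0\<close> by (simp add: e_def)
  define h where "h = e * r / M"
  have "h > 0" using assms \<open>e > 0\<close> \<open>M > 0\<close> by (simp add: h_def)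
  have amgm: "s \<le> e * s\<^sup>2 + 1 / (4 * e)" for s :: real
  proof -
    have "0 \<le> (2 * e * s - 1)\<^sup>2 / (4 * e)" using \<open>e > 0\<close> by simp
    also have "\<dots> = e * s\<^sup>2 + 1 / (4 * e) - s" using \<open>e > 0\<close> by (simp add: power2_eq_square field_simps)
    finally show ?thesis by simp
  qed
  have gb: "norm (A *v x + B *v u) \<le> M * e / l * running_cost x u + M / (2 * e)" for x u
  proof -
    have "norm (A *v x + B *v u) \<le> a * norm x + b * norm u"
      by (rule order_trans[OF norm_triangle_ineq add_mono[OF a b]])
    also have "\<dots> \<le> M * norm x + M * norm u"
      using \<open>a > 0\<close> \<open>b > 0\<close> by (intro add_mono mult_right_mono) (auto simp: M_def)
    also have "\<dots> \<le> M * (e * (norm x)\<^sup>2 + 1 / (4 * e)) + M * (e * (norm u)\<^sup>2 + 1 / (4 * e))"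
      using \<open>M > 0\<close> by (intro add_mono mult_left_mono amgm) auto
    also have "\<dots> = M * e / l * (l * ((norm x)\<^sup>2 + (norm u)\<^sup>2)) + M / (2 * e)"
      using \<open>l > 0\<close> \<open>e > 0\<close> by (simp add: field_simps)
    also have "\<dots> \<le> M * e / l * running_cost x u + M / (2 * e)"
      using \<open>M > 0\<close> \<open>l > 0\<close> \<open>e > 0\<close> by (intro add_right_mono mult_left_mono l) auto
    finally show ?thesis .
  qed
  have "norm (x t - x 0) \<le> r"
    if x: "control_traj A B x u" and c: "\<And>T. T \<ge> 0 \<Longrightarrow> cost x u T \<le> C" and t: "t \<in> {0..h}" for x u t
  proof -
    have int: "((\<lambda>t. A *v x t + B *v u t) has_integral x t - x 0) {0..t}"
      using x t by (simp add: control_traj_def)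
    have bint: "((\<lambda>s. M * e / l * running_cost (x s) (u s) + M / (2 * e)) has_integral
        M * e / l * cost x u t + t * (M / (2 * e))) {0..t}"
      using has_integral_const_real[of "M / (2 * e)" 0 t] t unfolding cost_def
      by (intro has_integral_add has_integral_mult_right integrable_integral running_cost_integrable x) auto
    have "norm (x t - x 0) \<le> M * e / l * cost x u t + t * (M / (2 * e))"
      using Henstock_Kurzweil_Integration.integral_norm_bound_integral[OF has_integral_integrable[OF int] has_integral_integrable[OF bint] gb]
      unfolding integral_unique[OF int] integral_unique[OF bint] .
    also have "\<dots> \<le> M * e / l * D + h * (M / (2 * e))"
      using c[of t] t \<open>M > 0\<close> \<open>e > 0\<close> \<open>l > 0\<close> by (intro add_mono mult_left_mono mult_right_mono) (auto simp: D_def)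
    also have "\<dots> = r / 2 + r / 2"
    proof -
      have "M * e / l * D = r / 2" using \<open>M > 0\<close> \<open>l > 0\<close> \<open>D > 0\<close> by (simp add: e_def field_simps)
      moreover have "h * (M / (2 * e)) = r / 2" using \<open>M > 0\<close> \<open>e > 0\<close> by (simp add: h_def field_simps)
      ultimately show ?thesis by (simp only:)
    qed
    finally show ?thesis by simp
  qed
  with \<open>h > 0\<close> show ?thesis by blast
qed

text \<open>An almost optimal trajectory stays near its initial state for a time that does not depend
  on how close to optimal it is, so a positive defect there would be paid in full.\<close>
lemma riccati_defect_nonpos: "(riccati_defect E *v x0) \<bullet> x0 \<le> 0"
proof (rule ccontr)
  assume "\<not> (riccati_defect E *v x0) \<bullet> x0 \<le> 0"
  define \<eta> where "\<eta> = (riccati_defect E *v x0) \<bullet> x0 / 2"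
  have "\<eta> > 0" using \<open>\<not> _\<close> by (simp add: \<eta>_def)
  have "continuous_on UNIV (\<lambda>x. (riccati_defect E *v x) \<bullet> x)"
    by (intro continuous_intros bounded_linear.continuous_on[OF matrix_vector_mul_bounded_linear])
  then have "isCont (\<lambda>x. (riccati_defect E *v x) \<bullet> x) x0" by (simp add: continuous_on_eq_continuous_at)
  then obtain d where "d > 0" and d: "\<And>x. dist x x0 < d \<Longrightarrow> dist ((riccati_defect E *v x) \<bullet> x) ((riccati_defect E *v x0) \<bullet> x0) < \<eta>"
    unfolding continuous_at_eps_delta using \<open>\<eta> > 0\<close> by blast
  have near: "\<eta> \<le> (riccati_defect E *v x) \<bullet> x" if "norm (x - x0) \<le> d / 2" for x
  proof -
    have "dist x x0 < d" using that \<open>d > 0\<close> by (simp add: dist_norm)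
    from d[OF this] have "(riccati_defect E *v x0) \<bullet> x0 - (riccati_defect E *v x) \<bullet> x < \<eta>"
      by (simp only: dist_real_def abs_less_iff) simp
    then show ?thesis by (simp add: \<eta>_def)
  qed
  obtain h where "h > 0" and h: "\<And>x u t. control_traj A B x u \<Longrightarrow> (\<And>T. T \<ge> 0 \<Longrightarrow> cost x u T \<le> value_fun x0 + 1) \<Longrightarrow>
      t \<in> {0..h} \<Longrightarrow> norm (x t - x 0) \<le> d / 2"
    using control_traj_near[of "value_fun x0 + 1" "d / 2"] value_fun_nonneg[of x0] \<open>d > 0\<close> by auto
  \<comment> \<open>A gap above the infimum, uniform over all admissible bounds, is the
    contradiction. Bounds beyond \<open>value_fun x0 + 1\<close> have it trivially; the others come
    from trajectories that stay where the defect form is at least \<eta> during all of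
    \<open>{0..h}\<close>.\<close>
  have "value_fun x0 + min 1 (\<eta> * h) \<le> c" if c: "admissible x0 c" for c
  proof (cases "c \<le> value_fun x0 + 1")
    case True
    obtain x u where x: "control_traj A B x u" "x 0 = x0" and cost: "\<And>T. T \<ge> 0 \<Longrightarrow> cost x u T \<le> c"
      using c by (auto simp: admissible_def)
    let ?g = "\<lambda>t. (riccati_defect E *v x t) \<bullet> x t + (R *v (u t + gain E *v x t)) \<bullet> (u t + gain E *v x t)"
    have gi: "(?g has_integral (cost x u h + ((E *v x h) \<bullet> x h - (E *v x 0) \<bullet> x 0))) {0..h}"
      using energy_balance[OF E x(1)] \<open>h > 0\<close> by simp
    have "integral {0..h} (\<lambda>t. \<eta>) \<le> integral {0..h} ?g"
    proof (rule integral_le)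
      show "?g integrable_on {0..h}" using gi by (rule has_integral_integrable)
      fix t assume t: "t \<in> {0..h}"
      have "norm (x t - x0) \<le> d / 2" using h[OF x(1) _ t] cost True x(2) by force
      from near[OF this] show "\<eta> \<le> ?g t" using R_nonneg[of "u t + gain E *v x t"] by simp
    qed auto
    then have "\<eta> * h \<le> cost x u h + value_fun (x h) - value_fun x0"
      using \<open>h > 0\<close> x(2) by (simp add: integral_unique[OF gi] value_E mult.commute)
    moreover have "value_fun (x h) \<le> c - cost x u h"
      using admissible_tail[OF x(1) cost, of h] \<open>h > 0\<close> by (intro value_fun_le) auto
    ultimately show ?thesis by simp
  qed auto
  then have "value_fun x0 + min 1 (\<eta> * h) \<le> value_fun x0" by (rule value_fun_greatest)
  then show False using \<open>\<eta> > 0\<close> \<open>h > 0\<close> by (simp add: min_le_iff_disj mult_le_0_iff)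
qed

lemma value_fun_riccati: "riccati_solution A B Q R E"
proof -
  have "riccati_defect E = 0"
  proof (rule symmetric_matrix_eqI[OF riccati_defect_symmetric[OF E]])
    show "transpose 0 = (0 :: real^'n^'n)" by (rule symmetric_matrixI) simp
    show "(riccati_defect E *v x) \<bullet> x = (0 *v x) \<bullet> x" for x
      using riccati_defect_nonneg[of x] riccati_defect_nonpos[of x] by simp
  qed
  then show ?thesis by (simp add: riccati_solution_iff)
qed

end

lemma riccati_solution_exists: "\<exists>E. sym_pos_semidef E \<and> riccati_solution A B Q R E"
proof -
  obtain E where E: "transpose E = E" "\<And>x. value_fun x = (E *v x) \<bullet> x"
    using value_fun_quadratic by blast
  have "sym_pos_semidef E"
    unfolding sym_pos_semidef_def E(2)[symmetric] using E(1) value_fun_nonneg by blast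
  with value_fun_riccati[OF E] show ?thesis by blast
qed

end

section \<open>Riccati solutions represent the value function\<close>

context lq_regulator
begin

text \<open>In the closed loop both the defect and the square vanish, so cost plus terminal form is
  constant in \<open>T\<close>; semidefiniteness allows the terminal form to be dropped.\<close>

lemma riccati_value_admissible:
  assumes "sym_pos_semidef E" "riccati_solution A B Q R E"
  shows "admissible x0 ((E *v x0) \<bullet> x0)"
proof -
  have E: "transpose E = E" using assms(1) by (simp add: sym_pos_semidef_def)
  obtain x where x0: "x 0 = x0" and x: "\<And>t. (x has_vector_derivative ((A - B ** gain E) *v x t + 0)) (at t)"
    using affine_ode_exists[of x0 "A - B ** gain E" 0] by blast
  define u where "u t = - (gain E *v x t)" for t
  have contx: "continuous_on UNIV x"
    using x by (intro continuous_at_imp_continuous_on) (blast intro: has_vector_derivative_continuous)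
  have traj: "control_traj A B x u"
  proof (rule control_trajI)
    show "continuous_on UNIV u" unfolding u_def
      by (intro continuous_intros contx bounded_linear.continuous_on[OF matrix_vector_mul_bounded_linear])
    show "(x has_vector_derivative (A *v x t + B *v u t)) (at t)" for t
    proof -
      have "(A - B ** gain E) *v x t + 0 = A *v x t + B *v u t"
        using matrix_vector_mult_diff_distrib[of B 0 "gain E *v x t"]
        by (simp add: u_def matrix_vector_mult_diff_rdistrib matrix_vector_mul_assoc)
      with x[of t] show ?thesis by simp
    qed
  qed
  have "cost x u T \<le> (E *v x0) \<bullet> x0" if "T \<ge> 0" for T
  proof -
    have "((\<lambda>t. 0) has_integral (cost x u T + ((E *v x T) \<bullet> x T - (E *v x 0) \<bullet> x 0))) {0..T}"
      using energy_balance[OF E traj that] assms(2) by (simp add: riccati_solution_iff u_def)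
    from has_integral_unique[OF this has_integral_0]
    have "cost x u T + (E *v x T) \<bullet> x T = (E *v x0) \<bullet> x0" using x0 by simp
    moreover have "0 \<le> (E *v x T) \<bullet> x T" using assms(1) by (simp add: sym_pos_semidef_def)
    ultimately show ?thesis by linarith
  qed
  then show ?thesis unfolding admissible_def using traj x0 by blast
qed

text \<open>With zero defect the energy identity gives that the form at \<open>x0\<close> is at most
  the cost up to \<open>T\<close> plus the form at \<open>x T\<close>. If the latter exceeded
  \<open>e\<close> at all times, coercivity would make the cost grow linearly beyond
  \<open>c\<close>.\<close>

lemma riccati_value_lower_bound:
  assumes E: "transpose E = E" and ric: "riccati_solution A B Q R E" and "admissible x0 c"
  shows "(E *v x0) \<bullet> x0 \<le> c"
proof (rule field_le_epsilon)
  fix e :: real assume "e > 0"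
  obtain x u where x: "control_traj A B x u" "x 0 = x0" and c: "\<And>T. T \<ge> 0 \<Longrightarrow> cost x u T \<le> c"
    using assms(3) by (auto simp: admissible_def)
  obtain l where "l > 0" and l: "\<And>x u. l * ((norm x)\<^sup>2 + (norm u)\<^sup>2) \<le> running_cost x u"
    using running_cost_coercive by blast
  obtain K where "K > 0" and K: "\<And>x y. \<bar>(E *v x) \<bullet> y\<bar> \<le> K * (norm x * norm y)"
    using matrix_vector_inner_bound[of E] by blast
  have "\<exists>T\<ge>0. (E *v x T) \<bullet> x T \<le> e"
  proof (rule ccontr)
    assume neg: "\<not> ?thesis"
    define d where "d = l * (e / K)"
    have "d > 0" using \<open>l > 0\<close> \<open>e > 0\<close> \<open>K > 0\<close> by (simp add: d_def)
    have lower: "d \<le> running_cost (x t) (u t)" if "t \<ge> 0" for t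
    proof -
      have "e \<le> K * (norm (x t))\<^sup>2"
        using neg that K[of "x t" "x t"] by (force simp: power2_eq_square)
      then have "e / K \<le> (norm (x t))\<^sup>2" using \<open>K > 0\<close> by (simp add: field_simps)
      then have "e / K \<le> (norm (x t))\<^sup>2 + (norm (u t))\<^sup>2"
        using zero_le_power2[of "norm (u t)"] by linarith
      then have "d \<le> l * ((norm (x t))\<^sup>2 + (norm (u t))\<^sup>2)"
        unfolding d_def using \<open>l > 0\<close> by (intro mult_left_mono) auto
      then show ?thesis using l[of "x t" "u t"] by linarith
    qed
    have "c \<ge> 0" using admissible_nonneg assms(3) by blast
    \<comment> \<open>At rate at least \<open>d\<close>, the cost up to this time reaches
      \<open>c + 1\<close>.\<close>
    define T where "T = (c + 1) / d"
    have "T \<ge> 0" using \<open>c \<ge> 0\<close> \<open>d > 0\<close> by (simp add: T_def)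
    have "integral {0..T} (\<lambda>t. d) \<le> cost x u T"
      unfolding cost_def using lower by (intro integral_le running_cost_integrable x(1)) auto
    then have "c + 1 \<le> cost x u T" using \<open>T \<ge> 0\<close> \<open>d > 0\<close> by (simp add: T_def)
    then show False using c[OF \<open>T \<ge> 0\<close>] by simp
  qed
  then obtain T where T: "T \<ge> 0" "(E *v x T) \<bullet> x T \<le> e" by blast
  have "0 \<le> cost x u T + ((E *v x T) \<bullet> x T - (E *v x 0) \<bullet> x 0)"
    using has_integral_nonneg[OF energy_balance[OF E x(1) T(1)]] R_nonneg ric
    by (simp add: riccati_solution_iff)
  then show "(E *v x0) \<bullet> x0 \<le> c + e" using T c[OF T(1)] x(2) by simp
qed

text \<open>All estimates are homogeneous in the state, so one \<open>hbar\<close> serves every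
  sample \<open>z\<close>. Bounding the error by \<open>x t\<close> instead of \<open>z\<close> lets
  the running cost at the same time absorb it.\<close>

lemma sampling_error:
  fixes K :: "real^'n^'m"
  shows "\<exists>hbar>0. \<forall>h x z. 0 < h \<longrightarrow> h \<le> hbar \<longrightarrow> x 0 = z \<longrightarrow>
    (\<forall>t. (x has_vector_derivative (A *v x t + B *v (- (K *v z)))) (at t)) \<longrightarrow>
    (\<forall>t\<in>{0..h}. (R *v (K *v (x t - z))) \<bullet> (K *v (x t - z)) \<le> running_cost (x t) (- (K *v z)) / 2)"
proof -
  obtain l where "l > 0" and l: "\<And>x u. l * ((norm x)\<^sup>2 + (norm u)\<^sup>2) \<le> running_cost x u"
    using running_cost_coercive by blast
  obtain a where "a > 0" and a: "\<And>x. norm (A *v x) \<le> a * norm x" using matrix_vector_norm_bound by blast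
  obtain b where "b > 0" and b: "\<And>x. norm ((A - B ** K) *v x) \<le> b * norm x" using matrix_vector_norm_bound by blast
  obtain k where "k > 0" and k: "\<And>x. norm (K *v x) \<le> k * norm x" using matrix_vector_norm_bound by blast
  obtain r where "r > 0" and r: "\<And>x y. \<bar>(R *v x) \<bullet> y\<bar> \<le> r * (norm x * norm y)"
    using matrix_vector_inner_bound[of R] by blast
  define c where "c = r * k\<^sup>2"
  have "c > 0" using \<open>r > 0\<close> \<open>k > 0\<close> by (simp add: c_def)
  have c: "(R *v (K *v y)) \<bullet> (K *v y) \<le> c * (norm y)\<^sup>2" for y
  proof -
    have "(R *v (K *v y)) \<bullet> (K *v y) \<le> r * (norm (K *v y) * norm (K *v y))"
      using r[of "K *v y" "K *v y"] by linarith
    also have "\<dots> \<le> r * ((k * norm y) * (k * norm y))"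
      using \<open>r > 0\<close> \<open>k > 0\<close> by (intro mult_left_mono mult_mono k) auto
    finally show ?thesis by (simp add: c_def power2_eq_square mult_ac)
  qed
  \<comment> \<open>The bound \<open>h * a \<le> 1 / 2\<close> absorbs the maximal deviation into
    itself; \<open>h * b \<le> 1 / 4\<close> keeps it below \<open>norm z / 2\<close>, so that
    \<open>z\<close> is comparable with \<open>x t\<close>; the last bound brings the error below
    half of the coercivity constant \<open>l\<close>.\<close>
  define hbar where "hbar = min (1 / (2 * a)) (min (1 / (4 * b)) (l / (8 * b * c)))"
  have "hbar > 0" using \<open>a > 0\<close> \<open>b > 0\<close> \<open>c > 0\<close> \<open>l > 0\<close> by (simp add: hbar_def)
  moreover have "(R *v (K *v (x t - z))) \<bullet> (K *v (x t - z)) \<le> running_cost (x t) (- (K *v z)) / 2"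
    if h: "0 < h" "h \<le> hbar" and x0: "x 0 = z"
      and x: "\<And>t. (x has_vector_derivative (A *v x t + B *v (- (K *v z)))) (at t)" and t: "t \<in> {0..h}" for h x z t
  proof -
    have h1: "h * a \<le> 1 / 2" and h2: "h * b \<le> 1 / 4" and h3: "4 * (h * b) * c \<le> l / 2"
      using h \<open>a > 0\<close> \<open>b > 0\<close> \<open>c > 0\<close> by (auto simp: hbar_def field_simps)
    have contx: "continuous_on {0..h} x"
      using x by (intro continuous_at_imp_continuous_on) (blast intro: has_vector_derivative_continuous)
    have "continuous_on {0..h} (\<lambda>t. norm (x t - z))" by (intro continuous_intros contx)
    moreover have "{0..h} \<noteq> {}" using h(1) by simp
    \<comment> \<open>The deviation is estimated at the point where it is largest, which replaces a
      Gronwall argument.\<close>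
    ultimately obtain s where s: "s \<in> {0..h}" and smax: "\<And>t. t \<in> {0..h} \<Longrightarrow> norm (x t - z) \<le> norm (x s - z)"
      using continuous_attains_sup[OF compact_Icc] by blast
    define m where "m = norm (x s - z)"
    have g: "norm (A *v x t + B *v (- (K *v z))) \<le> a * m + b * norm z" if "t \<in> {0..h}" for t
    proof -
      \<comment> \<open>The velocity is split into a part proportional to the deviation and the
        closed-loop velocity at the sample.\<close>
      have "A *v x t + B *v (- (K *v z)) = A *v (x t - z) + (A - B ** K) *v z"
        using matrix_vector_mult_diff_distrib[of B 0 "K *v z"]
        by (simp add: matrix_vector_mult_diff_distrib matrix_vector_mult_diff_rdistrib matrix_vector_mul_assoc)
      also have "norm \<dots> \<le> a * norm (x t - z) + b * norm z"
        by (rule order_trans[OF norm_triangle_ineq add_mono[OF a b]])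
      also have "\<dots> \<le> a * m + b * norm z"
        using smax[OF that] \<open>a > 0\<close> by (simp add: m_def)
      finally show ?thesis .
    qed
    have "m \<le> s * (a * m + b * norm z)"
    proof -
      have "((\<lambda>t. A *v x t + B *v (- (K *v z))) has_integral x s - x 0) {0..s}"
        using s has_vector_derivative_at_within[OF x] by (intro fundamental_theorem_of_calculus) auto
      then have "norm (x s - x 0) \<le> (a * m + b * norm z) * measure lborel {0..s}"
        using g s \<open>a > 0\<close> \<open>b > 0\<close>
        by (intro has_integral_bound_real[where f="\<lambda>t. A *v x t + B *v (- (K *v z))"]) (auto simp: m_def)
      then show ?thesis using s x0 by (simp add: m_def mult.commute)
    qed
    also have "\<dots> \<le> h * (a * m + b * norm z)"
      using s \<open>a > 0\<close> \<open>b > 0\<close> by (intro mult_right_mono) (auto simp: m_def)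
    also have "\<dots> = (h * a) * m + (h * b) * norm z" by (simp add: algebra_simps)
    also have "\<dots> \<le> 1 / 2 * m + (h * b) * norm z"
      by (intro add_right_mono mult_right_mono h1) (auto simp: m_def)
    finally have m: "m \<le> 2 * (h * b) * norm z" by simp
    also have "2 * (h * b) * norm z \<le> 2 * (1 / 4) * norm z"
      using h2 by (intro mult_right_mono mult_left_mono) auto
    finally have m': "m \<le> norm z / 2" by simp
    have xt: "norm (x t - z) \<le> m" using smax[OF t] by (simp add: m_def)
    have "norm z \<le> norm (x t) + norm (x t - z)"
      using norm_triangle_ineq4[of "x t" "x t - z"] by simp
    then have z: "norm z \<le> 2 * norm (x t)" using xt m' by linarith
    have "norm (x t - z) \<le> 2 * (h * b) * norm z" using xt m by linarith
    also have "\<dots> \<le> 2 * (h * b) * (2 * norm (x t))"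
      using h(1) \<open>b > 0\<close> by (intro mult_left_mono z) auto
    finally have xz: "norm (x t - z) \<le> 4 * (h * b) * norm (x t)" by simp
    have "(R *v (K *v (x t - z))) \<bullet> (K *v (x t - z)) \<le> c * (norm (x t - z))\<^sup>2" by (rule c)
    also have "\<dots> \<le> c * (4 * (h * b) * norm (x t))\<^sup>2"
      using xz \<open>c > 0\<close> by (intro mult_left_mono power_mono) auto
    \<comment> \<open>One factor \<open>4 * (h * b)\<close> of the square is at most 1; the other is
      spent on making \<open>c\<close> smaller than \<open>l / 2\<close>.\<close>
    also have "\<dots> = (4 * (h * b)) * (4 * (h * b) * c * (norm (x t))\<^sup>2)"
      by (simp add: power2_eq_square algebra_simps)
    also have "\<dots> \<le> 1 * (4 * (h * b) * c * (norm (x t))\<^sup>2)"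
      using h2 h(1) \<open>b > 0\<close> \<open>c > 0\<close> by (intro mult_right_mono) auto
    also have "\<dots> \<le> 1 * (l / 2 * (norm (x t))\<^sup>2)"
      using h3 by (intro mult_left_mono mult_right_mono) auto
    also have "\<dots> \<le> l * ((norm (x t))\<^sup>2 + (norm (K *v z))\<^sup>2) / 2"
      using \<open>l > 0\<close> by (simp add: algebra_simps)
    also have "\<dots> \<le> running_cost (x t) (- (K *v z)) / 2"
      using l[of "x t" "- (K *v z)"] by simp
    finally show ?thesis .
  qed
  ultimately show ?thesis by blast
qed

end

context stabilizable_lq_regulator
begin

lemma riccati_value:
  assumes "sym_pos_semidef E" "riccati_solution A B Q R E"
  shows "(E *v x) \<bullet> x = value_fun x"
proof (rule antisym)
  show "(E *v x) \<bullet> x \<le> value_fun x"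
    using assms unfolding sym_pos_semidef_def by (intro value_fun_greatest riccati_value_lower_bound) blast
  show "value_fun x \<le> (E *v x) \<bullet> x"
    by (rule value_fun_le[OF riccati_value_admissible[OF assms]])
qed

lemma E_inf: "sym_pos_semidef (E_inf A B Q R) \<and> riccati_solution A B Q R (E_inf A B Q R)"
proof -
  have "\<exists>!E. sym_pos_semidef E \<and> riccati_solution A B Q R E"
  proof (rule ex_ex1I[OF riccati_solution_exists])
    fix E F assume E: "sym_pos_semidef E \<and> riccati_solution A B Q R E" and F: "sym_pos_semidef F \<and> riccati_solution A B Q R F"
    then have "(E *v x) \<bullet> x = (F *v x) \<bullet> x" for x using riccati_value by presburger
    moreover have "transpose E = E" "transpose F = F" using E F by (simp_all add: sym_pos_semidef_def)
    ultimately show "E = F" using symmetric_matrix_eqI by blast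
  qed
  then show ?thesis unfolding E_inf_def by (rule theI')
qed

end

section \<open>Sample-and-hold feedback\<close>

lemma lipschitz_imp_abs_continuous_on_interval:
  assumes lip: "\<And>s t. a \<le> s \<Longrightarrow> s \<le> t \<Longrightarrow> t \<le> b \<Longrightarrow> norm (f t - f s) \<le> M * (t - s)"
  shows "abs_continuous_on_interval a b f"
  unfolding abs_continuous_on_interval_def
proof (intro allI impI)
  fix \<epsilon> :: real assume "\<epsilon> > 0"
  define N where "N = max M 1"
  have "N > 0" "M \<le> N" by (auto simp: N_def)
  have "(\<Sum>k\<in>d. norm (f (Sup k) - f (Inf k))) < \<epsilon>"
    if d: "d division_of S" "S \<subseteq> {a..b}" and small: "(\<Sum>k\<in>d. Sup k - Inf k) < \<epsilon> / N" for d S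
  proof -
    have "(\<Sum>k\<in>d. norm (f (Sup k) - f (Inf k))) \<le> (\<Sum>k\<in>d. N * (Sup k - Inf k))"
    proof (rule sum_mono)
      fix k assume "k \<in> d"
      then obtain u v where k: "k = {u..v}" using division_ofD(4)[OF d(1)] by (metis box_real(2))
      have "k \<subseteq> S" "k \<noteq> {}" using division_ofD(2,3)[OF d(1) \<open>k \<in> d\<close>] by auto
      then have "{u..v} \<subseteq> {a..b}" "u \<le> v" using subset_trans[OF _ d(2), of k] k by auto
      then have uv: "a \<le> u" "u \<le> v" "v \<le> b" by auto
      then have "norm (f v - f u) \<le> M * (v - u)" by (intro lip)
      also have "\<dots> \<le> N * (v - u)" using uv \<open>M \<le> N\<close> by (intro mult_right_mono) auto
      finally show "norm (f (Sup k) - f (Inf k)) \<le> N * (Sup k - Inf k)" using k uv by simp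
    qed
    also have "\<dots> = N * (\<Sum>k\<in>d. Sup k - Inf k)" by (simp add: sum_distrib_left)
    also have "\<dots> < N * (\<epsilon> / N)" using small \<open>N > 0\<close> by (intro mult_strict_left_mono)
    finally show ?thesis using \<open>N > 0\<close> by simp
  qed
  moreover have "\<epsilon> / N > 0" using \<open>\<epsilon> > 0\<close> \<open>N > 0\<close> by simp
  ultimately show "\<exists>\<delta>>0. \<forall>d S. d division_of S \<and> S \<subseteq> {a..b} \<and> (\<Sum>k\<in>d. Sup k - Inf k) < \<delta>
       \<longrightarrow> (\<Sum>k\<in>d. norm (f (Sup k) - f (Inf k))) < \<epsilon>"
    by blast
qed

text \<open>A bounded control gives a bounded velocity on bounded intervals, so the state is
  Lipschitz there.\<close>

lemma control_traj_AC_halfline: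
  assumes traj: "control_traj A B x u" and bdd: "\<And>T. bounded (u ` {0..T})"
  shows "x \<in> AC_halfline"
  unfolding AC_halfline_def
proof (intro CollectI allI impI)
  fix T :: real assume "T > 0"
  obtain U where U: "\<And>t. t \<in> {0..T} \<Longrightarrow> norm (u t) \<le> U"
    using bdd[of T] unfolding bounded_iff by (meson imageI)
  have "bounded (x ` {0..T})"
    using control_traj_continuous[OF traj] by (intro compact_imp_bounded compact_continuous_image) auto
  then obtain X where X: "\<And>t. t \<in> {0..T} \<Longrightarrow> norm (x t) \<le> X"
    unfolding bounded_iff by (meson imageI)
  obtain a where "a > 0" and a: "\<And>x. norm (A *v x) \<le> a * norm x" using matrix_vector_norm_bound by blast
  obtain b where "b > 0" and b: "\<And>x. norm (B *v x) \<le> b * norm x" using matrix_vector_norm_bound by blast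
  have g: "norm (A *v x t + B *v u t) \<le> a * X + b * U" if "t \<in> {0..T}" for t
  proof -
    have "norm (A *v x t + B *v u t) \<le> a * norm (x t) + b * norm (u t)"
      by (rule order_trans[OF norm_triangle_ineq add_mono[OF a b]])
    also have "\<dots> \<le> a * X + b * U"
      using X[OF that] U[OF that] \<open>a > 0\<close> \<open>b > 0\<close> by (intro add_mono mult_left_mono) auto
    finally show ?thesis .
  qed
  have M: "0 \<le> a * X + b * U" using order_trans[OF norm_ge_zero g[of 0]] \<open>T > 0\<close> by simp
  show "abs_continuous_on_interval 0 T x"
  proof (rule lipschitz_imp_abs_continuous_on_interval[where M = "a * X + b * U"])
    fix s t :: real assume st: "0 \<le> s" "s \<le> t" "t \<le> T"
    have "norm (x t - x s) \<le> (a * X + b * U) * measure lborel {s..t}"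
      using st g by (intro has_integral_bound_real[OF M finite.emptyI control_traj_increment[OF traj st(1,2)]]) auto
    then show "norm (x t - x s) \<le> (a * X + b * U) * (t - s)" using st by simp
  qed
qed

section \<open>Gluing flows with held controls\<close>

locale sample_and_hold =
  fixes A :: "real^'n^'n" and B :: "real^'m^'n" and h :: real
    and flow :: "real^'n \<Rightarrow> real \<Rightarrow> real^'n" and ctrl :: "real^'n \<Rightarrow> real^'m" and x0 :: "real^'n"
  assumes h_pos: "0 < h" and flow_0: "\<And>z. flow z 0 = z"
    and flow_deriv: "\<And>z t. (flow z has_vector_derivative (A *v flow z t + B *v ctrl z)) (at t)"
begin

primrec sample :: "nat \<Rightarrow> real^'n" where
  "sample 0 = x0"
| "sample (Suc i) = flow (sample i) h"

definition index :: "real \<Rightarrow> nat" where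
  "index t = nat \<lfloor>t / h\<rfloor>"

definition state :: "real \<Rightarrow> real^'n" where
  "state t = flow (sample (index t)) (t - index t * h)"

definition control :: "real \<Rightarrow> real^'m" where
  "control t = ctrl (sample (index t))"

lemma index_eq: "real i * h \<le> t \<Longrightarrow> t < real (Suc i) * h \<Longrightarrow> index t = i"
proof -
  assume "real i * h \<le> t" "t < real (Suc i) * h"
  then have "\<lfloor>t / h\<rfloor> = int i" using h_pos by (auto simp: floor_eq_iff field_simps)
  then show ?thesis by (simp add: index_def)
qed

lemma index_bounds:
  assumes "0 \<le> t"
  shows "real (index t) * h \<le> t" "t < real (Suc (index t)) * h"
proof -
  have "0 \<le> \<lfloor>t / h\<rfloor>" using assms h_pos by simp
  then have "real (index t) = of_int \<lfloor>t / h\<rfloor>" by (simp add: index_def)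
  then have "real (index t) \<le> t / h" "t / h < real (index t) + 1" by linarith+
  then show "real (index t) * h \<le> t" "t < real (Suc (index t)) * h"
    using h_pos by (simp_all add: field_simps)
qed

lemma control_eq: "real i * h \<le> t \<Longrightarrow> t < real (Suc i) * h \<Longrightarrow> control t = ctrl (sample i)"
  by (simp add: control_def index_eq)

text \<open>The right end is included, unlike in \<open>control_eq\<close>: there
  \<open>index\<close> has already jumped, but the next flow starts where the previous one ends.
  This agreement makes the glued state continuous.\<close>

lemma state_eq:
  assumes "real i * h \<le> t" "t \<le> real (Suc i) * h"
  shows "state t = flow (sample i) (t - real i * h)"
proof (cases "t = real (Suc i) * h")
  case True
  have "index t = Suc i" using True h_pos by (intro index_eq) auto
  then show ?thesis using True by (simp add: state_def flow_0 algebra_simps)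
next
  case False
  then have "index t = i" using assms by (intro index_eq) auto
  then show ?thesis by (simp add: state_def)
qed

lemma state_0: "state 0 = x0"
  using state_eq[of 0 0] h_pos by (simp add: flow_0)

lemma control_PC: "control \<in> PC_halfline (uniform_partition h)"
  unfolding PC_halfline_def uniform_partition_def
  using control_eq by (intro CollectI allI exI ballI) (auto simp del: of_nat_Suc)

lemma control_bounded: "bounded (control ` {0..T})"
proof (rule finite_imp_bounded, rule finite_subset)
  show "control ` {0..T} \<subseteq> (\<lambda>i. ctrl (sample i)) ` {..index T}"
  proof
    fix v assume "v \<in> control ` {0..T}"
    then obtain t where t: "0 \<le> t" "t \<le> T" "v = control t" by auto
    have "index t \<le> index T"
      using t h_pos unfolding index_def by (intro nat_mono floor_mono divide_right_mono) auto
    then show "v \<in> (\<lambda>i. ctrl (sample i)) ` {..index T}" using t by (auto simp: control_def)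
  qed
qed auto

lemma state_deriv:
  assumes "real i * h < t" "t < real (Suc i) * h"
  shows "(state has_vector_derivative (A *v state t + B *v control t)) (at t)"
proof -
  have "((\<lambda>t. flow (sample i) (t - real i * h)) has_vector_derivative
      1 *\<^sub>R (A *v flow (sample i) (t - real i * h) + B *v ctrl (sample i))) (at t)"
    by (rule vector_diff_chain_at[where f = "\<lambda>t. t - real i * h" and g = "flow (sample i)", unfolded o_def, OF _ flow_deriv])
       (auto intro!: derivative_eq_intros)
  then have "(state has_vector_derivative
      (A *v flow (sample i) (t - real i * h) + B *v ctrl (sample i))) (at t)"
    unfolding scaleR_one
    by (rule has_vector_derivative_transform_within_open[where S = "{real i * h<..<real (Suc i) * h}"])
       (use assms in \<open>auto simp del: of_nat_Suc intro!: state_eq[symmetric]\<close>)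
  then show ?thesis using assms state_eq[of i t] control_eq[of i t] by simp
qed

lemma off_grid:
  assumes "0 \<le> t" "t \<notin> range (\<lambda>i. real i * h)"
  shows "real (index t) * h < t \<and> t < real (Suc (index t)) * h"
  using index_bounds[OF assms(1)] assms(2) by (metis le_less rangeI)

lemma continuous_state: "continuous_on {0..real n * h} state"
proof (induction n)
  case (Suc n)
  have "continuous_on {real n * h..real (Suc n) * h} (\<lambda>t. flow (sample n) (t - real n * h))"
  proof (rule continuous_on_compose2[of UNIV "flow (sample n)"])
    show "continuous_on UNIV (flow (sample n))"
      using flow_deriv by (intro continuous_at_imp_continuous_on) (blast intro: has_vector_derivative_continuous)
  qed (auto intro!: continuous_intros)
  then have "continuous_on {real n * h..real (Suc n) * h} state"
    by (rule continuous_on_eq) (use state_eq in auto)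
  with Suc have "continuous_on ({0..real n * h} \<union> {real n * h..real (Suc n) * h}) state"
    by (intro continuous_on_closed_Un) auto
  moreover have "{0..real n * h} \<union> {real n * h..real (Suc n) * h} = {0..real (Suc n) * h}"
    using h_pos by (intro ivl_disj_un_two_touch) auto
  ultimately show ?case by simp
qed simp

lemma integrable_control:
  fixes f :: "real^'m \<Rightarrow> 'c::banach"
  shows "(\<lambda>t. f (control t)) integrable_on {0..real n * h}"
proof (induction n)
  case (Suc n)
  have "(\<lambda>t. f (control t)) integrable_on {real n * h..real (Suc n) * h}"
  \<comment> \<open>At the right end the control already has its next value, a single point that the
    integral ignores.\<close>
  proof (rule integrable_spike[OF integrable_const_ivl])
    show "negligible {real (Suc n) * h}" by simp
    show "f (control t) = f (ctrl (sample n))"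
      if "t \<in> {real n * h..real (Suc n) * h} - {real (Suc n) * h}" for t
      using that control_eq[of n t] by auto
  qed
  with Suc show ?case
    by (rule Henstock_Kurzweil_Integration.integrable_combine[rotated 2]) (use h_pos in auto)
qed (use integrable_on_refl[of _ "0::real"] in simp)

lemma le_grid: "\<exists>n. T \<le> real n * h"
  using reals_Archimedean3[OF h_pos] less_imp_le by blast

lemma control_traj: "control_traj A B state control"
  unfolding control_traj_def
proof (intro allI impI conjI)
  fix T :: real assume "0 \<le> T"
  obtain n where n: "T \<le> real n * h" using le_grid by blast
  show "control integrable_on {0..T}"
    using integrable_on_subinterval[OF integrable_control[of "\<lambda>u. u" n], of 0 T] n by simp
  show "(\<lambda>t. (norm (control t))\<^sup>2) integrable_on {0..T}"
    using integrable_on_subinterval[OF integrable_control[of "\<lambda>u. (norm u)\<^sup>2" n], of 0 T] n by simp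
  show "((\<lambda>t. A *v state t + B *v control t) has_integral state T - state 0) {0..T}"
  proof (rule fundamental_theorem_of_calculus_interior_strong[OF _ \<open>0 \<le> T\<close>])
    show "finite ((\<lambda>i. real i * h) ` {..n})" by simp
    show "continuous_on {0..T} state" using continuous_on_subset[OF continuous_state[of n]] n by simp
    fix t assume t: "t \<in> {0<..<T} - (\<lambda>i. real i * h) ` {..n}"
    have "t \<notin> range (\<lambda>i. real i * h)"
    proof
      assume "t \<in> range (\<lambda>i. real i * h)"
      then obtain i where i: "t = real i * h" by blast
      then have "real i * h < real n * h" using t n by simp
      then have "i < n" using h_pos by simp
      then show False using t i by auto
    qed
    then show "(state has_vector_derivative A *v state t + B *v control t) (at t)"
      using off_grid[of t] t state_deriv[of "index t" t] by simp
  qed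
qed

lemma solves: "solves_linear_control A B x0 state control"
  unfolding solves_linear_control_def
proof (intro conjI state_0)
  \<comment> \<open>At grid times the velocity may jump; the grid is countable, hence a null
    set.\<close>
  have "range (\<lambda>i. real i * h) \<in> null_sets lebesgue"
    by (intro null_sets_completionI countable_imp_null_set_lborel countable_image) auto
  then have "AE t in lebesgue. t \<notin> range (\<lambda>i. real i * h)" by (rule AE_not_in)
  then show "AE t in lebesgue_on {0..}. (state has_vector_derivative A *v state t + B *v control t) (at t within {0..})"
    by (subst AE_restrict_space_iff)
       (auto elim!: eventually_mono dest: off_grid intro: has_vector_derivative_at_within state_deriv)
qed

lemma AC: "state \<in> AC_halfline"
  by (rule control_traj_AC_halfline[OF control_traj control_bounded])

end

section \<open>Passage between truncated and total costs, and the sampled feedback\<close>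

context lq_regulator
begin

text \<open>Monotone convergence along the horizons \<open>{0..real n}\<close>.\<close>

lemma quadratic_cost_le:
  assumes x: "control_traj A B x u" and c: "\<And>T. T \<ge> 0 \<Longrightarrow> cost x u T \<le> c"
  shows "quadratic_cost Q R x u \<le> ennreal c"
proof -
  let ?q = "\<lambda>t. ennreal (running_cost (x t) (u t))"
  let ?f = "\<lambda>n t. ?q t * indicator {0..real n} t"
  have "quadratic_cost Q R x u = (\<integral>\<^sup>+t. ?q t * indicator {0..} t \<partial>lebesgue)"
    unfolding quadratic_cost_def running_cost_def[symmetric] by (subst nn_integral_restrict_space) auto
  also have "\<dots> = (\<integral>\<^sup>+t. (SUP n. ?f n t) \<partial>lebesgue)"
  proof (rule nn_integral_cong)
    fix t :: real
    show "?q t * indicator {0..} t = (SUP n. ?f n t)"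
    proof (rule antisym)
      obtain n where "t \<le> real n" using real_arch_simple by blast
      then have "?q t * indicator {0..} t \<le> ?f n t" by (auto simp: indicator_def)
      also have "\<dots> \<le> (SUP n. ?f n t)" by (rule SUP_upper) simp
      finally show "?q t * indicator {0..} t \<le> (SUP n. ?f n t)" .
      show "(SUP n. ?f n t) \<le> ?q t * indicator {0..} t"
        by (rule SUP_least) (auto simp: indicator_def)
    qed
  qed
  also have "\<dots> = (SUP n. \<integral>\<^sup>+t. ?f n t \<partial>lebesgue)"
  proof (rule nn_integral_monotone_convergence_SUP)
    show "incseq ?f" by (auto simp: incseq_def le_fun_def indicator_def)
    show "?f n \<in> borel_measurable lebesgue" for n
    proof -
      have "(\<lambda>t. running_cost (x t) (u t)) \<in> borel_measurable (lebesgue_on {0..real n})"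
        by (rule integrable_imp_measurable[OF running_cost_integrable[OF x]])
      then have "?q \<in> borel_measurable (lebesgue_on {0..real n})" by measurable
      then show ?thesis by (subst (asm) borel_measurable_restrict_space_iff_ennreal) auto
    qed
  qed
  also have "\<dots> \<le> ennreal c"
  proof (rule SUP_least)
    fix n :: nat
    have "(\<integral>\<^sup>+t. ?f n t \<partial>lebesgue) = (\<integral>\<^sup>+t. ?f n t \<partial>lborel)" by (rule nn_integral_completion)
    also have "\<dots> = ennreal (cost x u (real n))"
      unfolding cost_def
      by (rule nn_integral_has_integral_lebesgue'[OF running_cost_nonneg integrable_integral[OF running_cost_integrable[OF x]]])
    also have "\<dots> \<le> ennreal c" using c[of "real n"] by (intro ennreal_leI) simp
    finally show "(\<integral>\<^sup>+t. ?f n t \<partial>lebesgue) \<le> ennreal c" .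
  qed
  finally show ?thesis .
qed

text \<open>Here the fundamental theorem for absolutely continuous functions turns an
  almost-everywhere solution into its integral form.\<close>

lemma control_traj_of_solution:
  assumes x: "x \<in> AC_halfline" and u: "u \<in> L2_halfline" and sol: "solves_linear_control A B x0 x u"
  shows "control_traj A B x u"
  unfolding control_traj_def
proof (intro allI impI conjI)
  fix T :: real assume "0 \<le> T"
  have um: "u \<in> borel_measurable (lebesgue_on {0..})" and u2: "integrable (lebesgue_on {0..}) (\<lambda>t. (norm (u t))\<^sup>2)"
    using u by (auto simp: L2_halfline_def)
  have "(\<lambda>t. (norm (u t))\<^sup>2) integrable_on {0..}"
    using integrable_on_lebesgue_on[OF u2] by simp
  then show sq: "(\<lambda>t. (norm (u t))\<^sup>2) integrable_on {0..T}" by (rule integrable_on_subinterval) auto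
  show "u integrable_on {0..T}"
  proof (rule measurable_bounded_by_integrable_imp_integrable)
    show "u \<in> borel_measurable (lebesgue_on {0..T})"
      by (rule measurable_restrict_mono[OF um]) auto
    show "(\<lambda>t. 1 + (norm (u t))\<^sup>2) integrable_on {0..T}"
      using sq by (intro integrable_add) auto
    show "norm (u t) \<le> 1 + (norm (u t))\<^sup>2" for t
      using zero_le_power2[of "norm (u t) - 1/2"] by (simp add: power2_eq_square algebra_simps)
  qed auto
  have "AE t in lebesgue. t \<in> {0..} \<longrightarrow> (x has_vector_derivative (A *v x t + B *v u t)) (at t within {0..})"
    using sol unfolding solves_linear_control_def by (subst (asm) AE_restrict_space_iff) auto
  then obtain N where N: "N \<in> null_sets lebesgue"
    and deriv: "\<And>t. t \<in> {0..} - N \<Longrightarrow> (x has_vector_derivative (A *v x t + B *v u t)) (at t within {0..})"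
    by (elim AE_E3) auto
  \<comment> \<open>\<open>AC_halfline\<close> speaks of positive horizons only, so
    \<open>T = 0\<close> is treated apart.\<close>
  show "((\<lambda>t. A *v x t + B *v u t) has_integral x T - x 0) {0..T}"
  proof (cases "T = 0")
    case False
    show ?thesis
    proof (rule abs_continuous_on_interval_has_integral[OF \<open>0 \<le> T\<close>])
      show "abs_continuous_on_interval 0 T x" using x False \<open>0 \<le> T\<close> by (simp add: AC_halfline_def)
      show "negligible N" using N by (simp add: negligible_iff_null_sets)
      fix t assume "t \<in> {0..T} - N"
      then have "(x has_vector_derivative (A *v x t + B *v u t)) (at t within {0..})" using deriv by auto
      then show "(x has_vector_derivative (A *v x t + B *v u t)) (at t within {0..T})"
        by (rule has_vector_derivative_within_subset) auto
    qed
  qed (use has_integral_refl(2)[of _ "0::real"] in simp)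
qed

lemma admissible_of_solution:
  assumes "x \<in> AC_halfline" "u \<in> L2_halfline" and sol: "solves_linear_control A B x0 x u"
    and fin: "quadratic_cost Q R x u < \<infinity>"
  shows "\<exists>c. admissible x0 c"
proof -
  have x: "control_traj A B x u" by (rule control_traj_of_solution[OF assms(1-3)])
  obtain c where "c \<ge> 0" and c: "quadratic_cost Q R x u = ennreal c"
    using fin by (cases "quadratic_cost Q R x u") auto
  have "cost x u T \<le> c" for T
  proof -
    let ?q = "\<lambda>t. ennreal (running_cost (x t) (u t))"
    have "ennreal (cost x u T) = (\<integral>\<^sup>+t. ?q t * indicator {0..T} t \<partial>lborel)"
      unfolding cost_def
      by (rule nn_integral_has_integral_lebesgue'[OF running_cost_nonneg integrable_integral[OF running_cost_integrable[OF x]], symmetric])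
    also have "\<dots> = (\<integral>\<^sup>+t. ?q t * indicator {0..T} t \<partial>lebesgue)" by (rule nn_integral_completion[symmetric])
    also have "\<dots> \<le> (\<integral>\<^sup>+t. ?q t * indicator {0..} t \<partial>lebesgue)"
      by (intro nn_integral_mono) (auto simp: indicator_def)
    also have "\<dots> = ennreal c"
      unfolding c[symmetric] quadratic_cost_def running_cost_def[symmetric] by (subst nn_integral_restrict_space) auto
    finally show ?thesis using \<open>c \<ge> 0\<close> by (simp add: ennreal_le_iff)
  qed
  moreover have "x 0 = x0" using sol by (simp add: solves_linear_control_def)
  ultimately show ?thesis unfolding admissible_def using x by blast
qed

lemma sampled_feedback_cost:
  assumes E: "sym_pos_semidef E" and ric: "riccati_solution A B Q R E"
  shows "\<exists>hbar>0. \<forall>h. 0 < h \<and> h \<le> hbar \<longrightarrow>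
           (\<forall>x0. \<exists>x\<in>AC_halfline. \<exists>u\<in>PC_halfline (uniform_partition h).
              solves_linear_control A B x0 x u \<and> quadratic_cost Q R x u \<le> ennreal (2 * ((E *v x0) \<bullet> x0)))"
proof -
  let ?K = "gain E"
  have symE: "transpose E = E" using E by (simp add: sym_pos_semidef_def)
  obtain hbar where "hbar > 0" and hbar: "\<And>h x z t. 0 < h \<Longrightarrow> h \<le> hbar \<Longrightarrow> x 0 = z \<Longrightarrow>
      (\<And>t. (x has_vector_derivative (A *v x t + B *v (- (?K *v z)))) (at t)) \<Longrightarrow> t \<in> {0..h} \<Longrightarrow>
      (R *v (?K *v (x t - z))) \<bullet> (?K *v (x t - z)) \<le> running_cost (x t) (- (?K *v z)) / 2"
    using sampling_error[of ?K] by meson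
  have "\<exists>flow. \<forall>z. flow z 0 = z \<and> (\<forall>t. (flow z has_vector_derivative (A *v flow z t + B *v (- (?K *v z)))) (at t))"
    using affine_ode_exists[of _ A] by (intro choice allI) auto
  then obtain flow where flow0: "\<And>z. flow z 0 = z"
    and flow: "\<And>z t. (flow z has_vector_derivative (A *v flow z t + B *v (- (?K *v z)))) (at t)" by blast
  have "\<exists>x\<in>AC_halfline. \<exists>u\<in>PC_halfline (uniform_partition h).
      solves_linear_control A B x0 x u \<and> quadratic_cost Q R x u \<le> ennreal (2 * ((E *v x0) \<bullet> x0))"
    if h: "0 < h" "h \<le> hbar" for h x0
  proof -
    interpret sh: sample_and_hold A B h flow "\<lambda>z. - (?K *v z)" x0
      using h(1) flow0 flow by unfold_locales
    let ?w = "\<lambda>t. sh.control t + ?K *v sh.state t"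
    have half: "(R *v ?w t) \<bullet> ?w t \<le> running_cost (sh.state t) (sh.control t) / 2" if "t \<ge> 0" for t
    proof -
      define i where "i = sh.index t"
      have i: "real i * h \<le> t" "t < real (Suc i) * h" using sh.index_bounds[OF that] by (simp_all add: i_def)
      have st: "sh.state t = flow (sh.sample i) (t - real i * h)" using i by (intro sh.state_eq) auto
      have ct: "sh.control t = - (?K *v sh.sample i)" using i by (rule sh.control_eq)
      \<comment> \<open>As the held control is the feedback at the sample, the deviation from the
        optimal feedback is the gain applied to the sampling error.\<close>
      have w: "?w t = ?K *v (flow (sh.sample i) (t - real i * h) - sh.sample i)"
        by (simp add: st ct matrix_vector_mult_diff_distrib)
      show ?thesis
        unfolding w unfolding st ct
        by (rule hbar[OF h flow0 flow]) (use i in \<open>auto simp: algebra_simps\<close>)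
    qed
    have "cost sh.state sh.control T \<le> 2 * ((E *v x0) \<bullet> x0)" if "T \<ge> 0" for T
    proof -
      have bal: "((\<lambda>t. (R *v ?w t) \<bullet> ?w t) has_integral
        (cost sh.state sh.control T + ((E *v sh.state T) \<bullet> sh.state T - (E *v x0) \<bullet> x0))) {0..T}"
        using energy_balance[OF symE sh.control_traj that] ric by (simp add: riccati_solution_iff sh.state_0)
      have q: "((\<lambda>t. running_cost (sh.state t) (sh.control t) / 2) has_integral cost sh.state sh.control T / 2) {0..T}"
        unfolding cost_def
        by (intro has_integral_divide integrable_integral running_cost_integrable sh.control_traj)
      \<comment> \<open>Half of the cost is absorbed on the right; once the nonnegative terminal
        form is dropped, doubling gives the constant 2.\<close>
      have "cost sh.state sh.control T + ((E *v sh.state T) \<bullet> sh.state T - (E *v x0) \<bullet> x0) \<le> cost sh.state sh.control T / 2"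
        using bal q half by (rule has_integral_le) simp
      moreover have "0 \<le> (E *v sh.state T) \<bullet> sh.state T" using E by (simp add: sym_pos_semidef_def)
      ultimately show ?thesis by simp
    qed
    then show ?thesis using quadratic_cost_le[OF sh.control_traj] sh.AC sh.control_PC sh.solves by blast
  qed
  with \<open>hbar > 0\<close> show ?thesis by blast
qed

end

theorem lemma1:
  fixes A :: "real^'n^'n" and B :: "real^'m^'n"
    and Q :: "real^'n^'n" and R :: "real^'m^'m"
  assumes "sym_pos_def Q" and "sym_pos_def R"
    and "\<forall>x0. \<exists>x\<in>AC_halfline. \<exists>u\<in>L2_halfline.
           solves_linear_control A B x0 x u \<and> quadratic_cost Q R x u < \<infinity>"
  shows "\<exists>hbar>0. \<exists>cbar\<ge>0. \<forall>h. 0 < h \<and> h \<le> hbar \<longrightarrow>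
           (\<forall>x0. \<exists>x\<in>AC_halfline. \<exists>u\<in>PC_halfline (uniform_partition h).
              solves_linear_control A B x0 x u \<and>
              quadratic_cost Q R x u \<le> ennreal (cbar * ((E_inf A B Q R *v x0) \<bullet> x0)) \<and>
              ennreal (cbar * ((E_inf A B Q R *v x0) \<bullet> x0)) < \<infinity>)"
proof -
  interpret lq_regulator A B Q R using assms(1,2) by unfold_locales
  interpret stabilizable_lq_regulator A B Q R
    by unfold_locales (use assms(3) admissible_of_solution in blast)
  obtain hbar where "hbar > 0" and hbar: "\<forall>h. 0 < h \<and> h \<le> hbar \<longrightarrow>
           (\<forall>x0. \<exists>x\<in>AC_halfline. \<exists>u\<in>PC_halfline (uniform_partition h).
              solves_linear_control A B x0 x u \<and> quadratic_cost Q R x u \<le> ennreal (2 * ((E_inf A B Q R *v x0) \<bullet> x0)))"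
    using sampled_feedback_cost E_inf by blast
  show ?thesis
  proof (rule exI[of _ hbar], intro conjI exI[of _ "2::real"])
    show "\<forall>h. 0 < h \<and> h \<le> hbar \<longrightarrow>
           (\<forall>x0. \<exists>x\<in>AC_halfline. \<exists>u\<in>PC_halfline (uniform_partition h).
              solves_linear_control A B x0 x u \<and>
              quadratic_cost Q R x u \<le> ennreal (2 * ((E_inf A B Q R *v x0) \<bullet> x0)) \<and>
              ennreal (2 * ((E_inf A B Q R *v x0) \<bullet> x0)) < \<infinity>)"
      using hbar by (simp add: ennreal_less_top)
  qed (use \<open>hbar > 0\<close> in auto)
qed

end
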